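(* Let $f:\mathbb{T}^2\to\mathbb{T}^2$ be a homeomorphism homotopic to the identity. If $f$ is non-wandering and is an irrational pseudo-rotation, then $f$ is topologically transitive.
   Context: $\mathbb{T}^2=\mathbb{R}^2/\mathbb{Z}^2$. $f$ is an irrational pseudo-rotation if there exist a vector $\rho\in\mathbb{R}^2$ which is totally irrational (i.e. $1,\rho_1,\rho_2$ are linearly independent over $\mathbb{Q}$) and a lift $F:\mathbb{R}^2\to\mathbb{R}^2$ of $f$ such that $\lim_{n\to\infty}(F^n(z)-z)/n=\rho$ for all $z\in\mathbb{R}^2$. $f$ is non-wandering if there exists no non-empty open set $U$ with $f^n(U)\cap U=\emptyset$ for all $n\ge1$. $f$ is topologically transitive if for all non-empty open sets $U,V\subseteq\mathbb{T}^2$ there is $n\in\mathbb{Z}$ with $f^n(U)\cap V\neq\emptyset$. *)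

theory Defs
  imports "HOL-Analysis.Analysis"
begin

definition lattice_equiv :: "real^2 \<Rightarrow> real^2 \<Rightarrow> bool" where
  "lattice_equiv x y \<longleftrightarrow> (\<forall>i. x $ i - y $ i \<in> \<int>)"

quotient_type torus = "real^2" / lattice_equiv
  morphisms rep_torus proj_torus
proof (rule equivpI)
  show "reflp lattice_equiv"
    by (simp add: reflp_def lattice_equiv_def)
  show "symp lattice_equiv"
    unfolding symp_def lattice_equiv_def by (metis Ints_minus minus_diff_eq)
  show "transp lattice_equiv"
    unfolding transp_def lattice_equiv_def
  proof (intro allI impI)
    fix x y z :: "real^2" and i
    assume "\<forall>i. x $ i - y $ i \<in> \<int>" "\<forall>i. y $ i - z $ i \<in> \<int>"
    then have "(x $ i - y $ i) + (y $ i - z $ i) \<in> \<int>" by (intro Ints_add) auto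
    then show "x $ i - z $ i \<in> \<int>" by simp
  qed
qed

instantiation torus :: topological_space
begin

definition open_torus :: "torus set \<Rightarrow> bool" where
  "open_torus U \<longleftrightarrow> open (proj_torus -` U)"

instance
proof
  show "open (UNIV :: torus set)" by (simp add: open_torus_def)
next
  fix S T :: "torus set"
  assume "open S" "open T"
  then show "open (S \<inter> T)" by (auto simp: open_torus_def)
next
  fix K :: "torus set set"
  assume "\<forall>S\<in>K. open S"
  then show "open (\<Union>K)" by (auto simp: open_torus_def vimage_Union)
qed

end

definition totally_irrational :: "real^2 \<Rightarrow> bool" where
  "totally_irrational \<rho> \<longleftrightarrow>
    (\<forall>a b c :: rat. of_rat a + of_rat b * \<rho> $ 1 + of_rat c * \<rho> $ 2 = 0
       \<longrightarrow> a = 0 \<and> b = 0 \<and> c = 0)"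

definition is_lift :: "(real^2 \<Rightarrow> real^2) \<Rightarrow> (torus \<Rightarrow> torus) \<Rightarrow> bool" where
  "is_lift F f \<longleftrightarrow> continuous_on UNIV F \<and> (\<forall>z. proj_torus (F z) = f (proj_torus z))"

definition irrational_pseudo_rotation :: "(torus \<Rightarrow> torus) \<Rightarrow> bool" where
  "irrational_pseudo_rotation f \<longleftrightarrow>
    (\<exists>\<rho> F. totally_irrational \<rho> \<and> is_lift F f \<and>
       (\<forall>z. (\<lambda>n. ((F ^^ n) z - z) /\<^sub>R real n) \<longlonglongrightarrow> \<rho>))"

definition non_wandering :: "('a::topological_space \<Rightarrow> 'a) \<Rightarrow> bool" where
  "non_wandering f \<longleftrightarrow>
    \<not> (\<exists>U. open U \<and> U \<noteq> {} \<and> (\<forall>n\<ge>1. (f ^^ n) ` U \<inter> U = {}))"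

text \<open>The negative iterates are meaningful only when \<open>f\<close> is a bijection.\<close>

definition int_iterate :: "('a \<Rightarrow> 'a) \<Rightarrow> int \<Rightarrow> 'a \<Rightarrow> 'a" where
  "int_iterate f n = (if n \<ge> 0 then f ^^ nat n else inv f ^^ nat (- n))"

definition topologically_transitive :: "('a::topological_space \<Rightarrow> 'a) \<Rightarrow> bool" where
  "topologically_transitive f \<longleftrightarrow>
    (\<forall>U V. open U \<and> U \<noteq> {} \<and> open V \<and> V \<noteq> {} \<longrightarrow>
       (\<exists>n::int. int_iterate f n ` U \<inter> V \<noteq> {}))"

end

(*
  Upstairs, the saturations of two open sets which no iterate of f makes meet are disjoint
  open sets P and Q, invariant under F and the integer translations. As f is non-wandering, every
  component returns to itself under some T = F^n - w. If a component of P had no period in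
  the lattice, then T would be recurrent on it, and by Brouwer's theory of plane homeomorphisms T
  would have a fixed point, which makes the rotation vector rational. So it has a
  period v, hence contains v-periodic lines, whose integer translates confine every component of Q
  to a strip parallel to v. As the component is invariant under some T, the rotation vector has a
  rational relation.
*)
theory Submission
  imports Defs
begin

section \<open>Brouwer theory for plane maps of bounded displacement\<close>

text \<open>A recurrent orbit need not be periodic, so a return to a free connected open set is
  turned into a cycle by composing the map with a homeomorphism supported in that set; the class
  \<open>plane_shift\<close> is stable under this. A cycle of length k \<ge> 3 gives another such
  map and a free set that returns in k - 1 steps. The descent ends at 2-cycles, which a winding
  argument excludes. For a component C, Brouwer's theorem concerns the iterates of one map T, while
  non-wandering only yields some F^m z - u in C with m and u uncontrolled. Taking for n the least
  return time of C makes n divide m, and the absence of a lattice period then determines u, so that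
  every return is a power of T.\<close>

text \<open>\<open>exp h = 1\<close> confines \<open>h\<close> to 2\<pi>i\<int>, whose points are
  more than 1 apart. Continuous logarithms are compared through this below.\<close>

lemma continuous_exp_eq_1_constant:
  fixes h :: "'a::topological_space \<Rightarrow> complex"
  assumes "connected S" "continuous_on S h" "\<And>x. x \<in> S \<Longrightarrow> exp (h x) = 1"
    and "a \<in> S" "b \<in> S"
  shows "h a = h b"
proof -
  have "\<exists>e>0. \<forall>y. y \<in> S \<and> h y \<noteq> h x \<longrightarrow> e \<le> norm (h y - h x)" if "x \<in> S" for x
  proof (intro exI[of _ 1] conjI allI impI)
    fix y assume y: "y \<in> S \<and> h y \<noteq> h x"
    have "exp (h y - h x) = 1" using assms(3) y that by (simp add: exp_diff)
    then obtain n :: int where n: "Re (h y - h x) = 0" "Im (h y - h x) = of_int (2 * n) * pi"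
      by (auto simp: exp_eq_1)
    have "n \<noteq> 0" using n y by (auto simp: complex_eq_iff)
    then have "1 \<le> \<bar>of_int n :: real\<bar>" by linarith
    then have "1 * 1 \<le> \<bar>of_int n :: real\<bar> * (2 * pi)"
      using pi_gt3 by (intro mult_mono) auto
    also have "\<dots> = \<bar>Im (h y - h x)\<bar>" unfolding n(2) by (simp add: abs_mult)
    also have "\<dots> \<le> norm (h y - h x)" by (rule abs_Im_le_cmod)
    finally show "1 \<le> norm (h y - h x)" by simp
  qed simp
  from continuous_discrete_range_constant[OF assms(1,2) this] assms(4,5)
  show ?thesis by (metis constant_on_def)
qed

text \<open>\<open>g x - g y\<close> divided by \<open>x - y\<close> has a continuous logarithm in \<open>x\<close> and \<open>log (y - x)\<close>. Since \<open>g\<close> is close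
  to the identity at infinity, it is unchanged by a full turn of \<open>y\<close> around \<open>x\<close>, hence is
  symmetric in \<open>x, y\<close>. On pairs \<open>(x, g x)\<close> it is the increment of a logarithm of \<open>g x - x\<close> along
  the orbit, up to a constant in \<open>2\<pi>i\<int>\<close>. On a 2-cycle the increments cancel, so the quotient would be 1, but it is -1.\<close>

lemma fixed_point_free_no_period_two:
  fixes g :: "complex \<Rightarrow> complex"
  assumes cont: "continuous_on UNIV g" and inj: "inj g"
    and bdd: "bounded (range (\<lambda>z. g z - z))"
    and fpf: "\<And>z. g z \<noteq> z"
  shows "g (g x) \<noteq> x"
proof
  assume per: "g (g x) = x"
  \<comment> \<open>Using a logarithm of the difference of the two points makes the domain
    contractible, and injectivity of \<open>g\<close> keeps \<open>Q\<close> off 0.\<close>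
  define Q where "Q = (\<lambda>p. (g (fst p + exp (snd p)) - g (fst p)) / exp (snd p))"
  have contQ: "continuous_on UNIV Q"
    unfolding Q_def
    by (intro continuous_intros continuous_on_compose2[OF cont]) auto
  have Q0: "Q p \<noteq> 0" for p
    using injD[OF inj, of "fst p + exp (snd p)" "fst p"] by (auto simp: Q_def)
  obtain l where contl: "continuous_on UNIV l" and l: "\<And>p. Q p = exp (l p)"
    using continuous_logarithm_on_contractible[OF contQ] Q0 convex_imp_contractible[OF convex_UNIV]
    by (metis UNIV_I)
  have cl: "continuous_on S (\<lambda>z. l (a z, b z))" if "continuous_on S a" "continuous_on S b"
    for S :: "'b::topological_space set" and a b
    by (rule continuous_on_compose2[OF contl]) (auto intro!: continuous_intros that)
  obtain M where M: "M > 0" "\<And>z. norm (g z - z) \<le> M"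
    using bdd unfolding bounded_pos by auto
  \<comment> \<open>On the circle of radius 4M around 0 the two displacements contribute at most 2M,
    so \<open>Q\<close> is within 1/2 of 1.\<close>
  define R where "R = ln (4 * M)"
  have normR: "norm (exp (of_real R + \<i> * of_real t)) = 4 * M" for t
    using M by (simp add: R_def norm_exp_eq_Re)
  have QR: "norm (Q (0, of_real R + \<i> * of_real t) - 1) < 1" for t
  proof -
    define e where "e = exp (of_real R + \<i> * of_real t)"
    have e: "e \<noteq> 0" "norm e = 4 * M" using normR by (auto simp: e_def)
    have "Q (0, of_real R + \<i> * of_real t) - 1 = ((g e - e) - (g 0 - 0)) / e"
      using e by (simp add: Q_def e_def[symmetric] field_simps)
    also have "norm \<dots> \<le> (M + M) / (4 * M)"
      unfolding norm_divide e(2)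
      by (intro divide_right_mono order_trans[OF norm_triangle_ineq4] add_mono M(2)) (use M in auto)
    also have "\<dots> < 1" using M by simp
    finally show ?thesis .
  qed
  \<comment> \<open>\<open>Q\<close> stays in the right half-plane along this circle, so
    \<open>Ln\<close> gives a second continuous logarithm and \<open>l\<close> gains nothing over a
    full turn.\<close>
  have "l (0, of_real R + \<i> * of_real (2*pi)) - Ln (Q (0, of_real R + \<i> * of_real (2*pi)))
      = l (0, of_real R + \<i> * of_real 0) - Ln (Q (0, of_real R + \<i> * of_real 0))"
  proof (rule continuous_exp_eq_1_constant[of UNIV "\<lambda>t::real. l (0, of_real R + \<i> * of_real t) - Ln (Q (0, of_real R + \<i> * of_real t))"])
    have "Q (0, of_real R + \<i> * of_real t) \<notin> \<real>\<^sub>\<le>\<^sub>0" for t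
    proof
      assume "Q (0, of_real R + \<i> * of_real t) \<in> \<real>\<^sub>\<le>\<^sub>0"
      then have "Re (Q (0, of_real R + \<i> * of_real t)) \<le> 0" by (auto simp: complex_nonpos_Reals_iff)
      then show False using QR[of t] abs_Re_le_cmod[of "Q (0, of_real R + \<i> * of_real t) - 1"] by simp
    qed
    then show "continuous_on UNIV (\<lambda>t::real. l (0, of_real R + \<i> * of_real t) - Ln (Q (0, of_real R + \<i> * of_real t)))"
      by (intro continuous_intros cl continuous_on_compose2[OF contQ]) auto
    show "exp (l (0, of_real R + \<i> * of_real t) - Ln (Q (0, of_real R + \<i> * of_real t))) = 1" for t
      using Q0 by (simp add: exp_diff l[symmetric])
  qed auto
  moreover have "exp (of_real R + \<i> * of_real (2*pi)) = exp (of_real R + \<i> * of_real 0 :: complex)"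
    by (simp add: exp_add mult.commute)
  ultimately have lR: "l (0, of_real R + 2 * pi * \<i>) = l (0, of_real R)"
    by (simp add: Q_def mult_ac)
  have per1: "l (z, w + 2 * pi * \<i>) = l (z, w)" for z w
  proof -
    define d where "d = (\<lambda>p. l (fst p, snd p + 2 * pi * \<i>) - l (fst p, snd p))"
    have "d (z, w) = d (0, of_real R)"
    proof (rule continuous_exp_eq_1_constant[of UNIV d])
      show "continuous_on UNIV d"
        unfolding d_def by (intro continuous_intros cl)
      show "exp (d p) = 1" for p
        using Q0[of p] unfolding d_def
        by (simp add: exp_diff l[symmetric]) (simp add: Q_def exp_add)
    qed auto
    then show ?thesis using lR by (simp add: d_def)
  qed
  have pern: "l (z, w + of_int n * (2 * pi * \<i>)) = l (z, w)" for z w n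
  proof (induction n rule: int_induct[of _ 0])
    case (step1 i) then show ?case using per1[of z "w + of_int i * (2 * pi * \<i>)"] by (simp add: algebra_simps)
  next
    case (step2 i) then show ?case using per1[of z "w + of_int (i - 1) * (2 * pi * \<i>)"] by (simp add: algebra_simps)
  qed simp
  \<comment> \<open>Exchanging the points z and z + exp w changes the sign of their difference and
    leaves \<open>Q\<close> alone. The resulting constant \<open>s\<close> vanishes because two
    exchanges make a full turn.\<close>
  have sym: "l (z + exp w, w + pi * \<i>) = l (z, w)" for z w
  proof -
    define s where "s = (\<lambda>p. l (fst p + exp (snd p), snd p + pi * \<i>) - l (fst p, snd p))"
    have "s (z, w) = s (z + exp w, w + pi * \<i>)"
    proof (rule continuous_exp_eq_1_constant[of UNIV s])
      show "continuous_on UNIV s" unfolding s_def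
        by (intro continuous_intros cl)
      show "exp (s p) = 1" for p
        using Q0[of p] unfolding s_def
        by (simp add: exp_diff l[symmetric]) (simp add: Q_def exp_add divide_simps)
    qed auto
    moreover have "s (z, w) + s (z + exp w, w + pi * \<i>) = 0"
      using per1[of z w] by (simp add: s_def exp_add add.assoc mult_ac)
    ultimately show ?thesis by (simp add: s_def)
  qed
  have "continuous_on UNIV (\<lambda>z. g z - z)" by (intro continuous_intros cont)
  then obtain th where contth: "continuous_on UNIV th" and th: "\<And>z. g z - z = exp (th z)"
    using continuous_logarithm_on_contractible[of UNIV "\<lambda>z. g z - z"] fpf
      convex_imp_contractible[OF convex_UNIV] by (metis UNIV_I eq_iff_diff_eq_0)
  \<comment> \<open>\<open>Q (z, th z)\<close> is the quotient of two successive displacements, (g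
    (g z) - g z) / (g z - z), so \<open>m\<close> has values in 2\<pi>i\<int>.\<close>
  define m where "m = (\<lambda>z. l (z, th z) - (th (g z) - th z))"
  have expm: "exp (m z) = 1" for z
    unfolding m_def exp_diff l[symmetric] th[symmetric]
    using fpf[of z] fpf[of "g z"] by (simp add: Q_def th[symmetric])
  have "m x = m (g x)"
  proof (rule continuous_exp_eq_1_constant[of UNIV m])
    show "continuous_on UNIV m" unfolding m_def
      by (intro continuous_intros cl contth continuous_on_compose2[OF contth] cont) auto
  qed (auto simp: expm)
  moreover have "l (x, th x) + l (g x, th (g x)) = m x + m (g x)"
    using per by (simp add: m_def)
  ultimately have m2: "l (x, th x) + l (g x, th (g x)) = 2 * m x" by simp
  \<comment> \<open>On the 2-cycle the displacements are opposite, so their logarithms differ by an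
    odd multiple of \<pi>i, which \<open>pern\<close> and \<open>sym\<close> absorb.\<close>
  have "exp (th (g x)) = exp (th x + pi * \<i>)"
    using th[of x] th[of "g x"] per by (simp add: exp_add) (metis minus_diff_eq)
  then obtain n :: int where "th (g x) = th x + pi * \<i> + of_int (2 * n) * pi * \<i>"
    unfolding exp_eq by (auto simp: mult_ac)
  then have "l (g x, th (g x)) = l (g x, th x + pi * \<i>)"
    using pern[of "g x" "th x + pi * \<i>" n] by (simp add: mult_ac)
  also have "\<dots> = l (x, th x)" using sym[of x "th x"] by (simp add: th[symmetric])
  finally have "l (g x, th (g x)) = l (x, th x)" .
  with m2 have "l (x, th x) = m x" by simp
  then have "Q (x, th x) = 1" using l expm by metis
  moreover have "Q (x, th x) = -1"
    using per fpf[of x] by (simp add: Q_def th[symmetric] divide_simps)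
  ultimately show False by simp
qed

section \<open>Free sets and perturbations supported in them\<close>

text \<open>Bounded displacement stands in for preservation of orientation. It excludes maps such as
  (x, y) \<mapsto> (-x, y + \<phi> x) with \<phi> continuous, \<phi> 0 = 1 and \<phi> 1 = \<phi>
  (-1) = 0, which has a 2-cycle but no fixed point.\<close>

definition plane_shift :: "(complex \<Rightarrow> complex) \<Rightarrow> bool" where
  "plane_shift g \<longleftrightarrow> continuous_on UNIV g \<and> inj g \<and> bounded (range (\<lambda>z. g z - z)) \<and> (\<forall>z. g z \<noteq> z)"

lemma plane_shiftD:
  assumes "plane_shift g"
  shows "continuous_on UNIV g" "inj g" "bounded (range (\<lambda>z. g z - z))" "g z \<noteq> z"
  using assms by (auto simp: plane_shift_def)

lemma continuous_on_UNIV_funpow: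
  fixes g :: "'a::topological_space \<Rightarrow> 'a"
  shows "continuous_on UNIV g \<Longrightarrow> continuous_on UNIV (g ^^ n)"
proof (induction n)
  case (Suc n)
  then show ?case using continuous_on_compose[of UNIV "g ^^ n" g] by (simp add: continuous_on_subset)
qed auto

text \<open>Freeness of \<open>N\<close> prevents new fixed points: if z = \<phi> (g z) with g z in
  \<open>N\<close>, then z is in \<open>N\<close> as well, since \<open>\<phi>\<close> maps
  \<open>N\<close> into itself.\<close>

lemma plane_shift_perturb:
  assumes g: "plane_shift g" and phi: "continuous_on UNIV \<phi>" "inj \<phi>"
    and supp: "{z. \<phi> z \<noteq> z} \<subseteq> N" "bounded {z. \<phi> z \<noteq> z}" and free: "g ` N \<inter> N = {}"
  shows "plane_shift (\<phi> \<circ> g)"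
proof -
  note g' = plane_shiftD[OF g]
  have supp': "\<phi> (\<phi> z) \<noteq> \<phi> z" if "\<phi> z \<noteq> z" for z
    using that phi(2) by (auto dest: injD)
  have NN: "\<phi> z \<in> N" if "z \<in> N" for z
    using supp(1) supp' that by (cases "\<phi> z = z") auto
  obtain M where M: "\<And>z. norm (g z - z) \<le> M"
    using g'(3) unfolding bounded_iff by auto
  obtain L where L: "\<And>z. \<phi> z \<noteq> z \<Longrightarrow> norm z \<le> L" "L > 0"
    using supp(2) unfolding bounded_pos by auto
  have phib: "norm (\<phi> z - z) \<le> 2 * L" for z
  proof (cases "\<phi> z = z")
    case False
    then show ?thesis
      using L(1)[of z] L(1)[of "\<phi> z"] supp'[of z] norm_triangle_ineq4[of "\<phi> z" z] by linarith
  qed (use L in simp)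
  show ?thesis unfolding plane_shift_def
  proof (intro conjI allI)
    show "continuous_on UNIV (\<phi> \<circ> g)"
      using continuous_on_compose[OF g'(1), of \<phi>] phi(1) continuous_on_subset by blast
    show "inj (\<phi> \<circ> g)" using g'(2) phi(2) by (rule inj_compose[rotated])
    show "bounded (range (\<lambda>z. (\<phi> \<circ> g) z - z))"
    proof (rule boundedI)
      fix w assume "w \<in> range (\<lambda>z. (\<phi> \<circ> g) z - z)"
      then obtain z where "w = (\<phi> (g z) - g z) + (g z - z)" by auto
      then show "norm w \<le> 2 * L + M"
        using norm_triangle_ineq[of "\<phi> (g z) - g z" "g z - z"] phib[of "g z"] M[of z] by simp
    qed
    show "(\<phi> \<circ> g) z \<noteq> z" for z
    proof
      assume *: "(\<phi> \<circ> g) z = z"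
      show False
      proof (cases "g z \<in> N")
        case True
        then have "z \<in> N" using NN * by force
        then show False using True free by blast
      next
        case False
        then have "\<phi> (g z) = g z" using supp(1) by blast
        then show False using * g'(4)[of z] by simp
      qed
    qed
  qed
qed

lemma exists_supported_homeo_moving_point:
  fixes a b :: complex
  assumes "open N" "connected N" "a \<in> N" "b \<in> N"
  obtains \<phi> where "continuous_on UNIV \<phi>" "inj \<phi>" "\<phi> a = b"
    "{z. \<phi> z \<noteq> z} \<subseteq> N" "bounded {z. \<phi> z \<noteq> z}"
proof -
  have hull: "affine hull N = UNIV"
    using assms affine_hull_open by blast
  have "openin (top_of_set (affine hull N)) N" using assms(1) unfolding hull by simp
  then obtain f g where fg: "homeomorphism UNIV UNIV f g" "f a = b"
    "{x. \<not> (f x = x \<and> g x = x)} \<subseteq> N" "bounded {x. \<not> (f x = x \<and> g x = x)}"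
    by (rule homeomorphism_moving_point[of N UNIV a b]) (use assms hull in auto)
  show thesis
  proof (rule that[of f])
    show "continuous_on UNIV f" "inj f"
      using fg(1) by (auto simp: homeomorphism_def intro: inj_on_inverseI)
    show "bounded {z. f z \<noteq> z}"
      by (rule bounded_subset[OF fg(4)]) auto
  qed (use fg in auto)
qed

lemma free_small_ball:
  assumes "plane_shift g" "open O'" "z \<in> O'"
  obtains e where "e > 0" "ball z e \<subseteq> O'" "g ` ball z e \<inter> ball z e = {}"
proof -
  obtain U V where UV: "open U" "open V" "z \<in> U" "g z \<in> V" "U \<inter> V = {}"
    using hausdorff[of z "g z"] plane_shiftD(4)[OF assms(1)] by metis
  have "open (O' \<inter> (U \<inter> g -` V))"
    using UV assms plane_shiftD(1)[OF assms(1)] by (intro open_Int open_vimage) auto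
  moreover have "z \<in> O' \<inter> (U \<inter> g -` V)" using UV assms by auto
  ultimately obtain e where e: "e > 0" "ball z e \<subseteq> O' \<inter> (U \<inter> g -` V)"
    using openE by blast
  show thesis by (rule that[OF e(1)]) (use e UV in auto)
qed

text \<open>Compactness separates \<open>K\<close> from its image by open sets; passing to a
  component restores connectedness, which is what lets points be moved inside the
  neighbourhood.\<close>

lemma free_compact_connected_nbhd:
  assumes "plane_shift g" "compact K" "connected K" "K \<noteq> {}" "g ` K \<inter> K = {}"
  obtains N where "open N" "connected N" "K \<subseteq> N" "g ` N \<inter> N = {}"
proof -
  note g' = plane_shiftD[OF assms(1)]
  have "compact (g ` K)"
    using assms(2) g'(1) by (meson compact_continuous_image continuous_on_subset subset_UNIV)
  then have "closed (g ` K)" "K \<inter> g ` K = {}" using assms(5) by (auto intro: compact_imp_closed)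
  then obtain U V where UV: "open U" "open V" "K \<subseteq> U" "g ` K \<subseteq> V" "U \<inter> V = {}"
    using separation_normal_compact[OF assms(2)] by metis
  define W where "W = U \<inter> g -` V"
  have W: "open W" "K \<subseteq> W"
    using UV g'(1) unfolding W_def by (auto intro!: open_Int open_vimage)
  obtain a where a: "a \<in> K" using assms by blast
  show thesis
  proof (rule that[of "connected_component_set W a"])
    show "open (connected_component_set W a)" by (rule open_connected_component[OF W(1)])
    show "K \<subseteq> connected_component_set W a"
      using a W assms by (intro connected_component_maximal)
    have "connected_component_set W a \<subseteq> W" by (rule connected_component_subset)
    then show "g ` connected_component_set W a \<inter> connected_component_set W a = {}"
      using UV unfolding W_def by blast
  qed auto
qed

text \<open>A homeomorphism supported in \<open>N\<close> takes the returning point back to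
  \<open>x\<close>. The intermediate points lie outside \<open>N\<close>, so they do not feel it and
  k is the exact period.\<close>

lemma return_imp_periodic_perturbation:
  assumes g: "plane_shift g" and N: "open N" "connected N" "g ` N \<inter> N = {}"
    and x: "x \<in> N" "(g ^^ k) x \<in> N" "\<And>j. 1 \<le> j \<Longrightarrow> j < k \<Longrightarrow> (g ^^ j) x \<notin> N" and "k \<ge> 1"
  obtains h where "plane_shift h" "(h ^^ k) x = x" "\<And>j. 1 \<le> j \<Longrightarrow> j < k \<Longrightarrow> (h ^^ j) x \<noteq> x"
proof -
  obtain \<phi> where phi: "continuous_on UNIV \<phi>" "inj \<phi>" "\<phi> ((g ^^ k) x) = x"
    "{z. \<phi> z \<noteq> z} \<subseteq> N" "bounded {z. \<phi> z \<noteq> z}"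
    using exists_supported_homeo_moving_point[OF N(1,2) x(2,1)] by metis
  have eq: "((\<phi> \<circ> g) ^^ j) x = (g ^^ j) x" if "j < k" for j
    using that
  proof (induction j)
    case (Suc j)
    then show ?case using x(3)[of "Suc j"] phi(4) by auto
  qed auto
  show thesis
  proof (rule that[of "\<phi> \<circ> g"])
    show "plane_shift (\<phi> \<circ> g)"
      by (rule plane_shift_perturb[OF g phi(1,2,4,5) N(3)])
    obtain k' where "k = Suc k'" using \<open>k \<ge> 1\<close> by (cases k) auto
    then show "((\<phi> \<circ> g) ^^ k) x = x" using eq[of k'] phi(3) by simp
    show "((\<phi> \<circ> g) ^^ j) x \<noteq> x" if "1 \<le> j" "j < k" for j
      using eq[of j] x that by metis
  qed
qed

text \<open>Freeness rules out a return at time 1, so a return at time 2 would close up to a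
  2-cycle. This is the base of the induction on return times.\<close>

lemma free_no_second_return:
  assumes g: "plane_shift g" and N: "open N" "connected N" "g ` N \<inter> N = {}"
  shows "(g ^^ 2) ` N \<inter> N = {}"
proof (rule ccontr)
  assume "(g ^^ 2) ` N \<inter> N \<noteq> {}"
  then obtain x where x: "x \<in> N" "(g ^^ 2) x \<in> N" by blast
  have "(g ^^ j) x \<notin> N" if "1 \<le> j" "j < 2" for j
  proof -
    have "j = 1" using that by simp
    then show ?thesis using x N(3) by auto
  qed
  then obtain h where h: "plane_shift h" "(h ^^ 2) x = x"
    using return_imp_periodic_perturbation[OF g N x] by (metis one_le_numeral)
  then show False
    using fixed_point_free_no_period_two[OF plane_shiftD(1-3)[OF h(1)], of x] plane_shiftD(4)[OF h(1)]
    by (simp add: numeral_2_eq_2)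
qed

section \<open>Shortening a cycle\<close>

text \<open>The open ball of radius r around \<open>x\<close> meets its image iff some p has
  \<open>m p < r\<close>, so the minimum of \<open>m\<close> is the largest free radius. Outside
  \<open>cball x R\<close> the value of \<open>m\<close> exceeds \<open>m x\<close>, hence the
  minimum exists.\<close>

lemma maximal_free_ball:
  assumes g: "plane_shift g"
  obtains y r where "r > 0" "dist x y = r" "dist x (g y) = r" "g ` ball x r \<inter> ball x r = {}"
proof -
  note g' = plane_shiftD[OF g]
  define m where "m = (\<lambda>p. max (dist x p) (dist x (g p)))"
  define R where "R = dist x (g x)"
  have "R > 0" using g'(4)[of x] unfolding R_def by (metis zero_less_dist_iff)
  have "continuous_on (cball x R) m"
    unfolding m_def by (intro continuous_intros continuous_on_subset[OF g'(1)]) auto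
  moreover have "cball x R \<noteq> {}" using \<open>R > 0\<close> by simp
  ultimately obtain y where y: "y \<in> cball x R" "\<And>p. p \<in> cball x R \<Longrightarrow> m y \<le> m p"
    using continuous_attains_inf[OF compact_cball] by metis
  have min: "m y \<le> m p" for p
  proof (cases "p \<in> cball x R")
    case False
    have "m y \<le> m x" using y(2) \<open>R > 0\<close> by auto
    then show ?thesis using False by (simp add: m_def R_def max_def split: if_splits)
  qed (use y in auto)
  define r where "r = m y"
  have le: "dist x y \<le> r" "dist x (g y) \<le> r" by (auto simp: r_def m_def)
  have "r > 0"
  proof (rule ccontr)
    assume "\<not> r > 0"
    then have "dist x y = 0" "dist x (g y) = 0" using le zero_le_dist[of x y] zero_le_dist[of x "g y"] by linarith+
    then show False using g'(4)[of y] by simp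
  qed
  have free: "g ` ball x r \<inter> ball x r = {}"
  proof (rule ccontr)
    assume "g ` ball x r \<inter> ball x r \<noteq> {}"
    then obtain p where "dist x p < r" "dist x (g p) < r" by auto
    then have "m p < r" by (simp add: m_def)
    then show False using min[of p] by (simp add: r_def)
  qed
  show thesis
  proof (rule that[OF \<open>r > 0\<close> _ _ free])
    \<comment> \<open>If \<open>y\<close> were inside the ball, the open image of the ball would
      contain \<open>g y\<close>, a point of the closure of the ball, and the two would meet. The
      other equality uses the preimage in the same way.\<close>
    show "dist x y = r"
    proof (rule ccontr)
      assume "dist x y \<noteq> r"
      then have "y \<in> ball x r" using le by simp
      moreover have "open (g ` ball x r)"
        using g' by (intro invariance_of_domain continuous_on_subset[OF g'(1)]) (auto intro: inj_on_subset)
      moreover have "g y \<in> closure (ball x r)" using le \<open>r > 0\<close> by simp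
      ultimately show False using free open_Int_closure_eq_empty[of "g ` ball x r" "ball x r"] by blast
    qed
    show "dist x (g y) = r"
    proof (rule ccontr)
      assume "dist x (g y) \<noteq> r"
      then have "y \<in> g -` ball x r" using le by simp
      moreover have "open (g -` ball x r)" using g'(1) by (intro open_vimage) auto
      moreover have "y \<in> closure (ball x r)" using le \<open>r > 0\<close> by simp
      ultimately show False using free open_Int_closure_eq_empty[of "g -` ball x r" "ball x r"] by blast
    qed
  qed
qed

lemma closed_segment_radius:
  fixes x z :: complex
  assumes "dist x z = r" "r > 0"
  shows "closed_segment x z \<subseteq> insert z (ball x r)"
proof
  fix w assume "w \<in> closed_segment x z"
  then obtain u where u: "0 \<le> u" "u \<le> 1" "w = (1 - u) *\<^sub>R x + u *\<^sub>R z" by (auto simp: in_segment)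
  then have "x - w = u *\<^sub>R (x - z)" by (simp add: algebra_simps)
  then have "dist x w = u * r" using u assms(1) by (simp add: dist_norm)
  then show "w \<in> insert z (ball x r)" using u assms by (cases "u = 1") auto
qed

text \<open>The two radii to \<open>y\<close> and \<open>g y\<close> in the maximal free ball around \<open>x\<close> give an arc
  \<open>S1 \<union> g ` S2\<close> from \<open>x\<close> to \<open>g x\<close> which meets its image only at \<open>g x\<close>. Cut off just before \<open>g x\<close>,
  at \<open>g p\<close>, it is free, and after a perturbation near \<open>g (g x)\<close> the orbit of \<open>g p\<close>
  falls onto that of \<open>x\<close>, one step earlier.\<close>

lemma periodic_imp_shorter_return:
  assumes g: "plane_shift g" and "k \<ge> 3" and per: "(g ^^ k) x = x"
    and min: "\<And>j. 1 \<le> j \<Longrightarrow> j < k \<Longrightarrow> (g ^^ j) x \<noteq> x"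
  obtains h N where "plane_shift h" "open N" "connected N" "h ` N \<inter> N = {}" "(h ^^ (k - 1)) ` N \<inter> N \<noteq> {}"
proof -
  note g' = plane_shiftD[OF g]
  have ginj: "g a = g b \<longleftrightarrow> a = b" for a b using g'(2) by (auto dest: injD)
  obtain y r where r: "r > 0" "dist x y = r" "dist x (g y) = r" and free: "g ` ball x r \<inter> ball x r = {}"
    using maximal_free_ball[OF g] by metis
  define B where "B = ball x r"
  have B: "open B" "connected B" "g ` B \<inter> B = {}" "x \<in> B"
    using free r by (auto simp: B_def)
  have yB: "y \<notin> B" "g y \<notin> B" "y \<in> closure B" "g y \<in> closure B"
    using r by (auto simp: B_def)
  have BB: "g a \<notin> B" if "a \<in> B" for a using B(3) that by blast
  have BB2: "g (g a) \<notin> B" if "a \<in> B" for a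
    using free_no_second_return[OF g B(1-3)] that by (auto simp: numeral_2_eq_2)
  \<comment> \<open>\<open>g y\<close> is a limit of points of \<open>B\<close>, so if its image
    were in \<open>B\<close>, nearby points of \<open>B\<close> would be mapped into
    \<open>B\<close> too.\<close>
  have ggy: "g (g y) \<notin> B"
  proof
    assume "g (g y) \<in> B"
    moreover have "open (g -` B)" using g'(1) B(1) by (intro open_vimage) auto
    ultimately show False using yB open_Int_closure_eq_empty[of "g -` B" B] B(3) by blast
  qed
  have gB: "g a \<noteq> y" if "a \<in> B" for a
  proof
    assume "g a = y"
    moreover have "open (g ` B)"
      using g' B by (intro invariance_of_domain continuous_on_subset[OF g'(1)]) (auto intro: inj_on_subset)
    ultimately show False using that yB open_Int_closure_eq_empty[of "g ` B" B] B(3) by blast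
  qed
  define S1 where "S1 = closed_segment x (g y)"
  define S2 where "S2 = closed_segment y x"
  have S1: "S1 \<subseteq> insert (g y) B" using closed_segment_radius[OF r(3,1)] by (simp add: S1_def B_def)
  have S2: "S2 \<subseteq> insert y B"
    using closed_segment_radius[OF r(2,1)] by (simp add: S2_def B_def closed_segment_commute)
  define x2 where "x2 = g (g x)"
  have x2: "x2 \<notin> S1 \<union> g ` S2"
    using S1 S2 BB2[of x] B(4) BB[of x] gB[of x] by (auto simp: x2_def ginj)
  have x2j: "(g ^^ j) x2 \<noteq> x2" if "1 \<le> j" "j \<le> k - 2" for j
  proof
    assume *: "(g ^^ j) x2 = x2"
    have "(g ^^ 2) ((g ^^ j) x) = (g ^^ j) ((g ^^ 2) x)"
      by (metis add.commute comp_apply funpow_add)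
    also have "\<dots> = (g ^^ 2) x" using * by (simp add: x2_def numeral_2_eq_2)
    finally have "(g ^^ j) x = x" by (simp add: numeral_2_eq_2 ginj)
    then show False using min[of j] that \<open>k \<ge> 3\<close> by auto
  qed
  have cpt: "compact (S1 \<union> g ` S2)"
    using g'(1) by (auto simp: S1_def S2_def intro!: compact_Un compact_continuous_image intro: continuous_on_subset)
  \<comment> \<open>The perturbation will live in a ball inside this set: it has to miss the arc and
    the orbit of \<open>x2\<close> up to its arrival at \<open>x\<close> after k - 2 steps.\<close>
  define O' where "O' = - (S1 \<union> g ` S2) \<inter> - ((\<lambda>j. (g ^^ j) x2) ` {1..k-2})"
  have "open O'" unfolding O'_def
    using cpt by (intro open_Int open_Compl finite_imp_closed compact_imp_closed) auto
  moreover have "x2 \<in> O'" using x2 x2j unfolding O'_def by force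
  ultimately obtain e where e: "e > 0" "ball x2 e \<subseteq> O'" "g ` ball x2 e \<inter> ball x2 e = {}"
    using free_small_ball[OF g] by metis
  define E where "E = ball x2 e"
  have E: "open E" "connected E" "g ` E \<inter> E = {}" "x2 \<in> E" "E \<inter> (S1 \<union> g ` S2) = {}"
    "\<And>j. 1 \<le> j \<Longrightarrow> j \<le> k - 2 \<Longrightarrow> (g ^^ j) x2 \<notin> E"
    using e by (auto simp: E_def O'_def)
  have "open (g -` (g -` E))" using E(1) g'(1) by (intro open_vimage) auto
  moreover have "x \<in> g -` (g -` E)" using E(4) by (simp add: x2_def)
  ultimately obtain d where d: "d > 0" "ball x d \<subseteq> g -` (g -` E)" using openE by blast
  \<comment> \<open>This puts \<open>p\<close> at distance at most d/2 from \<open>x\<close>, so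
    that \<open>g (g p)\<close> falls in \<open>E\<close>; the bound 1 keeps \<open>p\<close> on the
    radius to \<open>y\<close>.\<close>
  define s where "s = min 1 (d / (2 * r))"
  have s: "0 < s" "s \<le> 1" "s * r < d"
    using d r by (auto simp: s_def min_def field_simps)
  define p where "p = x + s *\<^sub>R (y - x)"
  have nyx: "norm (y - x) = r" "norm (g y - x) = r" using r by (auto simp: dist_norm norm_minus_commute)
  have pE: "g (g p) \<in> E"
  proof -
    have "dist x p = s * r" using s nyx by (simp add: p_def dist_norm)
    then have "p \<in> ball x d" using s by simp
    then show ?thesis using d by blast
  qed
  define T where "T = closed_segment y p"
  have Tform: "\<exists>t. 0 < t \<and> z = x + t *\<^sub>R (y - x)" if zT: "z \<in> T" for z
  proof -
    obtain u where u: "0 \<le> u" "u \<le> 1" "z = (1 - u) *\<^sub>R y + u *\<^sub>R p"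
      using zT unfolding T_def in_segment by blast
    have "z = x + ((1 - u) + u * s) *\<^sub>R (y - x)" by (simp add: u(3) p_def algebra_simps)
    moreover have "0 < (1 - u) + u * s"
      using u s by (cases "u = 0") (auto intro: add_nonneg_pos)
    ultimately show ?thesis by blast
  qed
  have "p \<in> S2"
    unfolding S2_def in_segment by (rule exI[of _ "1 - s"]) (use s in \<open>auto simp: p_def algebra_simps\<close>)
  then have TS2: "T \<subseteq> S2" unfolding T_def S2_def by (simp add: subset_closed_segment)
  have xT: "x \<notin> T" using Tform[of x] nyx r by auto
  \<comment> \<open>Distinct radii of a circle share only the centre, which \<open>T\<close>
    omits.\<close>
  have S1T: "S1 \<inter> T = {}"
  proof (rule ccontr)
    assume "S1 \<inter> T \<noteq> {}"
    then obtain z where z: "z \<in> S1" "z \<in> T" by blast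
    obtain t where t: "0 < t" "z = x + t *\<^sub>R (y - x)" using Tform[OF z(2)] by blast
    obtain u where u: "0 \<le> u" "z = (1 - u) *\<^sub>R x + u *\<^sub>R g y" using z(1) unfolding S1_def in_segment by blast
    have eq: "t *\<^sub>R (y - x) = u *\<^sub>R (g y - x)" using t u by (simp add: algebra_simps)
    have "norm (t *\<^sub>R (y - x)) = norm (u *\<^sub>R (g y - x))" using eq by simp
    then have "t = u" using t u r nyx by simp
    then show False using eq t g'(4)[of y] by simp
  qed
  define K where "K = S1 \<union> g ` T"
  have T': "T \<subseteq> insert y B" using TS2 S2 by blast
  have KE: "K \<inter> E = {}" using E(5) TS2 by (auto simp: K_def)
  have Kfree: "g ` K \<inter> K = {}"
  proof -
    have "g b \<notin> insert (g y) B" if "b \<in> insert (g y) B" for b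
      using that BB ggy g'(4) gB yB(1) by (auto simp: ginj)
    then have "g ` S1 \<inter> S1 = {}" using S1 by blast
    moreover have "g ` g ` T \<inter> S1 = {}"
    proof -
      have "g (g b) \<notin> insert (g y) B" if "b \<in> insert y B" for b
        using that BB2 ggy g'(4) gB yB(1) by (auto simp: ginj)
      then show ?thesis using T' S1 by blast
    qed
    moreover have "g ` S1 \<inter> g ` T = {}"
      using S1T by (metis image_Int[OF g'(2)] image_empty)
    moreover have "g ` g ` T \<inter> g ` T = {}"
    proof -
      have "g b \<notin> insert y B" if "b \<in> insert y B" for b
        using that BB gB yB g'(4) by auto
      then have "g ` T \<inter> T = {}" using T' by blast
      then show ?thesis by (metis image_Int[OF g'(2)] image_empty)
    qed
    ultimately show ?thesis unfolding K_def by (simp add: image_Un Int_Un_distrib Int_Un_distrib2)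
  qed
  obtain \<psi> where psi: "continuous_on UNIV \<psi>" "inj \<psi>" "\<psi> (g (g p)) = x2"
    "{z. \<psi> z \<noteq> z} \<subseteq> E" "bounded {z. \<psi> z \<noteq> z}"
    using exists_supported_homeo_moving_point[OF E(1,2) pE E(4)] by metis
  define h where "h = \<psi> \<circ> g"
  have h: "plane_shift h" unfolding h_def
    by (rule plane_shift_perturb[OF g psi(1,2,4,5) E(3)])
  have psiE: "\<psi> z \<in> E \<longleftrightarrow> z \<in> E" for z
  proof (cases "\<psi> z = z")
    case False
    then have "\<psi> (\<psi> z) \<noteq> \<psi> z" using psi(2) by (auto dest: injD)
    then show ?thesis using False psi(4) by blast
  qed auto
  have "h ` K \<inter> K = {}"
  proof (rule ccontr)
    assume "h ` K \<inter> K \<noteq> {}"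
    then obtain a where a: "a \<in> K" "\<psi> (g a) \<in> K" by (auto simp: h_def)
    then have "g a \<notin> E" using KE psiE by blast
    then have "\<psi> (g a) = g a" using psi(4) by blast
    then show False using a Kfree by auto
  qed
  moreover have "compact K"
    using g'(1) by (auto simp: K_def S1_def T_def intro!: compact_Un compact_continuous_image intro: continuous_on_subset)
  moreover have "connected K" unfolding K_def
  proof (rule connected_Un)
    show "connected (g ` T)"
      using g'(1) by (auto simp: T_def intro!: connected_continuous_image intro: continuous_on_subset)
    show "S1 \<inter> g ` T \<noteq> {}" by (auto simp: S1_def T_def)
  qed (simp add: S1_def)
  moreover have "x \<in> K" "g p \<in> K" by (auto simp: K_def S1_def T_def)
  ultimately obtain N where N: "open N" "connected N" "K \<subseteq> N" "h ` N \<inter> N = {}"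
    using free_compact_connected_nbhd[OF h, of K] by blast
  have hj: "(h ^^ j) x2 = (g ^^ j) x2" if "j \<le> k - 2" for j
    using that
  proof (induction j)
    case (Suc j)
    then have "(h ^^ Suc j) x2 = h ((g ^^ j) x2)" by simp
    also have "\<dots> = \<psi> ((g ^^ Suc j) x2)" by (simp add: h_def)
    also have "\<dots> = (g ^^ Suc j) x2"
    proof -
      have "(g ^^ Suc j) x2 \<notin> E" by (rule E(6)) (use Suc.prems in auto)
      then show ?thesis using psi(4) by blast
    qed
    finally show ?case .
  qed auto
  \<comment> \<open>The saved step: \<open>h\<close> takes \<open>g p\<close> to \<open>x2\<close>
    at once, whereas \<open>x\<close> needs two steps of \<open>g\<close> to get there.\<close>
  have "(h ^^ (k - 1)) (g p) = (h ^^ (k - 2)) (h (g p))"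
  proof -
    have "k - 1 = Suc (k - 2)" using \<open>k \<ge> 3\<close> by simp
    then have "h ^^ (k - 1) = h ^^ (k - 2) \<circ> h" using funpow_Suc_right[of "k - 2" h] by argo
    then show ?thesis by simp
  qed
  also have "h (g p) = x2" using psi(3) by (simp add: h_def)
  also have "(h ^^ (k - 2)) x2 = (g ^^ (k - 2)) ((g ^^ 2) x)"
    unfolding hj[OF order_refl] by (simp add: x2_def numeral_2_eq_2)
  also have "\<dots> = (g ^^ (k - 2 + 2)) x" by (simp only: funpow_add comp_apply)
  also have "k - 2 + 2 = k" using \<open>k \<ge> 3\<close> by simp
  also note per
  finally have "(h ^^ (k - 1)) (g p) = x" .
  moreover have "x \<in> N" "g p \<in> N" using N(3) \<open>x \<in> K\<close> \<open>g p \<in> K\<close> by auto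
  ultimately have "(h ^^ (k - 1)) ` N \<inter> N \<noteq> {}" by blast
  then show thesis using that[OF h N(1,2,4)] by blast
qed

text \<open>Induction on the return time over all maps and sets together, since closing a cycle
  changes the map and shortening it changes both. The induction hypothesis makes a return at time k
  the first one, as needed for exact period k.\<close>

theorem brouwer_free_no_return:
  assumes "plane_shift g" "open N" "connected N" "g ` N \<inter> N = {}" "k \<ge> 1"
  shows "(g ^^ k) ` N \<inter> N = {}"
  using assms
proof (induction k arbitrary: g N rule: less_induct)
  case (less k)
  show ?case
  proof (rule ccontr)
    assume ne: "(g ^^ k) ` N \<inter> N \<noteq> {}"
    then obtain x where x: "x \<in> N" "(g ^^ k) x \<in> N" by blast
    have "k \<noteq> 1" using ne less.prems(4) by auto
    moreover have "k \<noteq> 2" using ne free_no_second_return[OF less.prems(1-4)] by auto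
    ultimately have "k \<ge> 3" using less.prems(5) by linarith
    have nr: "(g ^^ j) x \<notin> N" if "1 \<le> j" "j < k" for j
      using less.IH[OF that(2) less.prems(1-4) that(1)] x by blast
    obtain h where h: "plane_shift h" "(h ^^ k) x = x" "\<And>j. 1 \<le> j \<Longrightarrow> j < k \<Longrightarrow> (h ^^ j) x \<noteq> x"
      using return_imp_periodic_perturbation[OF less.prems(1-4) x nr less.prems(5)] by blast
    obtain h' N' where "plane_shift h'" "open N'" "connected N'" "h' ` N' \<inter> N' = {}"
      "(h' ^^ (k - 1)) ` N' \<inter> N' \<noteq> {}"
      using periodic_imp_shorter_return[OF h(1) \<open>k \<ge> 3\<close> h(2,3)] by blast
    then show False using less.IH[of "k - 1" h' N'] \<open>k \<ge> 3\<close> by (simp add: le_diff_conv2)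
  qed
qed

section \<open>Periodic lines in the plane\<close>

lemma continuous_on_vector2:
  assumes "continuous_on A a" "continuous_on A b"
  shows "continuous_on A (\<lambda>z. vector [a z, b z] :: real^2)"
proof -
  have "continuous_on A (\<lambda>z. if i = 1 then a z else b z)" for i :: 2
    using assms by (cases "i = 1") auto
  then have "continuous_on A (\<lambda>z. (\<chi> i. if i = 1 then a z else b z) :: real^2)"
    by (rule continuous_on_vec_lambda)
  moreover have "(\<chi> i. if i = 1 then a z else b z) = (vector [a z, b z] :: real^2)" for z
    by (simp add: vec_eq_iff forall_2)
  ultimately show ?thesis by simp
qed

text \<open>Clamping one coordinate of each path puts both in a common box with endpoints on its
  sides. A crossing of the clamped paths is genuine: there each clamped coordinate equals the free
  coordinate of the other path, which is strictly inside the box.\<close>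

lemma fashoda_clamped:
  fixes g h :: "real \<Rightarrow> real^2"
  assumes "path g" "path h" "S > 0" "L1 < L2"
    and "pathstart g $ 1 \<le> - S" "pathfinish g $ 1 \<ge> S" "\<And>z. z \<in> path_image g \<Longrightarrow> L1 < z $ 2 \<and> z $ 2 < L2"
    and "pathstart h $ 2 \<le> L1" "pathfinish h $ 2 \<ge> L2" "\<And>z. z \<in> path_image h \<Longrightarrow> \<bar>z $ 1\<bar> < S"
  shows "path_image g \<inter> path_image h \<noteq> {}"
proof -
  define cg where "cg = (\<lambda>z::real^2. vector [max (- S) (min S (z $ 1)), z $ 2] :: real^2)"
  define ch where "ch = (\<lambda>z::real^2. vector [z $ 1, max L1 (min L2 (z $ 2))] :: real^2)"
  have c: "continuous_on A cg" "continuous_on A ch" for A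
    unfolding cg_def ch_def by (intro continuous_on_vector2 continuous_intros)+
  obtain z where z: "z \<in> path_image (cg \<circ> g)" "z \<in> path_image (ch \<circ> h)"
  proof (rule fashoda[of "cg \<circ> g" "ch \<circ> h" "vector [-S, L1]" "vector [S, L2]"])
    show "path (cg \<circ> g)" "path (ch \<circ> h)"
      using assms c by (auto intro!: path_continuous_image)
    show "path_image (cg \<circ> g) \<subseteq> cbox (vector [-S, L1]) (vector [S, L2])"
    proof -
      have "cg z \<in> cbox (vector [-S, L1]) (vector [S, L2])" if "z \<in> path_image g" for z
        using assms(3) assms(7)[OF that] by (auto simp: mem_box_cart forall_2 cg_def)
      then show ?thesis by (auto simp: path_image_compose)
    qed
    show "path_image (ch \<circ> h) \<subseteq> cbox (vector [-S, L1]) (vector [S, L2])"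
    proof -
      have "ch z \<in> cbox (vector [-S, L1]) (vector [S, L2])" if "z \<in> path_image h" for z
        using assms(4) assms(10)[OF that] by (auto simp: mem_box_cart forall_2 ch_def)
      then show ?thesis by (auto simp: path_image_compose)
    qed
  qed (use assms in \<open>auto simp: cg_def ch_def pathstart_compose pathfinish_compose\<close>)
  then obtain p q where pq: "p \<in> path_image g" "z = cg p" "q \<in> path_image h" "z = ch q"
    by (auto simp: path_image_compose)
  then have e: "max (- S) (min S (p $ 1)) = q $ 1" "p $ 2 = max L1 (min L2 (q $ 2))"
    by (auto simp: cg_def ch_def vec_eq_iff forall_2)
  have "p = q"
    unfolding vec_eq_iff forall_2
    using e assms(7)[OF pq(1)] assms(10)[OF pq(3)] by (auto simp: max_def min_def split: if_splits)
  then show ?thesis using pq by blast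
qed

lemma translated_paths_join:
  fixes v :: "real^2"
  assumes "path \<gamma>" "pathfinish \<gamma> = pathstart \<gamma> + v"
  shows "\<exists>g. path g \<and> pathstart g = pathstart \<gamma> \<and> pathfinish g = pathstart \<gamma> + real (Suc n) *\<^sub>R v \<and>
           path_image g \<subseteq> (\<Union>k::nat. (+) (real k *\<^sub>R v) ` path_image \<gamma>)"
proof (induction n)
  case 0
  have "path_image \<gamma> \<subseteq> (\<Union>k::nat. (+) (real k *\<^sub>R v) ` path_image \<gamma>)"
    by (rule order_trans[OF _ UN_upper[of 0]]) auto
  then show ?case using assms by (intro exI[of _ \<gamma>]) auto
next
  case (Suc n)
  then obtain g where g: "path g" "pathstart g = pathstart \<gamma>" "pathfinish g = pathstart \<gamma> + real (Suc n) *\<^sub>R v"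
    "path_image g \<subseteq> (\<Union>k::nat. (+) (real k *\<^sub>R v) ` path_image \<gamma>)" by blast
  define d where "d = (+) (real (Suc n) *\<^sub>R v) \<circ> \<gamma>"
  have "real (Suc (Suc n)) *\<^sub>R v = real (Suc n) *\<^sub>R v + v"
    unfolding of_nat_Suc[of "Suc n"] scaleR_add_left by simp
  then have d: "path d" "pathstart d = pathfinish g" "pathfinish d = pathstart \<gamma> + real (Suc (Suc n)) *\<^sub>R v"
    using assms g by (auto simp: d_def path_translation_eq pathstart_translation pathfinish_translation
      add.commute add.left_commute simp del: of_nat_Suc)
  have "path_image d = (+) (real (Suc n) *\<^sub>R v) ` path_image \<gamma>"
    by (simp add: d_def path_image_translation)
  then have "path_image d \<subseteq> (\<Union>k::nat. (+) (real k *\<^sub>R v) ` path_image \<gamma>)" by blast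
  then show ?case
    using g d by (intro exI[of _ "g +++ d"]) (auto simp: path_image_join)
qed

text \<open>\<open>z \<bullet> rot90 v\<close> measures position across the lines parallel to
  \<open>v\<close>. Without normalisation \<open>rot90\<close> keeps lattice vectors in the lattice,
  so bounds on it become rational relations.\<close>

definition rot90 :: "real^2 \<Rightarrow> real^2" where "rot90 v = vector [- (v $ 2), v $ 1]"

lemma inner_rot90: "z \<bullet> rot90 v = - (z $ 1 * v $ 2) + z $ 2 * v $ 1"
  by (simp add: rot90_def inner_vec_def sum_2)

lemma inner_rot90_self [simp]: "v \<bullet> rot90 v = 0"
  by (simp add: inner_rot90)

lemma rot90_inner_rot90: "rot90 v \<bullet> rot90 v = v \<bullet> v"
  by (simp add: rot90_def inner_vec_def sum_2)

lemma inner_rot90_inject: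
  assumes "v \<noteq> 0" "x \<bullet> v = y \<bullet> v" "x \<bullet> rot90 v = y \<bullet> rot90 v"
  shows "x = y"
proof -
  define d where "d = x - y"
  have d: "d $ 1 * v $ 1 + d $ 2 * v $ 2 = 0" "- (d $ 1 * v $ 2) + d $ 2 * v $ 1 = 0"
    using assms(2,3) unfolding inner_rot90 by (simp_all add: d_def inner_vec_def sum_2 algebra_simps)
  have vv: "v $ 1 * v $ 1 + v $ 2 * v $ 2 \<noteq> 0"
    using assms(1) by (simp add: vec_eq_iff forall_2 sum_squares_eq_zero_iff)
  have "d $ 1 * (v $ 1 * v $ 1 + v $ 2 * v $ 2) = 0" "d $ 2 * (v $ 1 * v $ 1 + v $ 2 * v $ 2) = 0"
    using d by algebra+
  then have "d $ 1 = 0" "d $ 2 = 0" using vv by (metis mult_eq_0_iff)+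
  then have "d = 0" by (simp add: vec_eq_iff forall_2)
  then show ?thesis by (simp add: d_def)
qed

text \<open>A path in \<open>A\<close> from \<open>c\<close> to \<open>c + v\<close> extends periodically to a line
  which separates the two half-planes on either side of it.\<close>

lemma periodic_set_meets_crossing_path:
  fixes A D :: "(real^2) set"
  assumes v: "v \<noteq> 0" and inv: "(+) v ` A \<subseteq> A" "(+) (- v) ` A \<subseteq> A"
    and \<gamma>: "path \<gamma>" "path_image \<gamma> \<subseteq> A" "pathfinish \<gamma> = pathstart \<gamma> + v"
    and bd: "\<And>z. z \<in> path_image \<gamma> \<Longrightarrow> L1 < z \<bullet> rot90 v \<and> z \<bullet> rot90 v < L2"
    and \<delta>: "path \<delta>" "pathstart \<delta> \<bullet> rot90 v \<le> L1" "pathfinish \<delta> \<bullet> rot90 v \<ge> L2"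
  shows "A \<inter> path_image \<delta> \<noteq> {}"
proof -
  define c where "c = pathstart \<gamma>"
  have inv': "(\<lambda>z. z + real k *\<^sub>R v) ` A \<subseteq> A" "(\<lambda>z. z - real k *\<^sub>R v) ` A \<subseteq> A" for k
  proof (induction k)
    case (Suc k)
    { case 1
      have "z + real (Suc k) *\<^sub>R v = v + (z + real k *\<^sub>R v)" for z by (simp add: algebra_simps)
      then show ?case using Suc(1) inv(1) by fastforce }
    { case 2
      have "z - real (Suc k) *\<^sub>R v = - v + (z - real k *\<^sub>R v)" for z by (simp add: algebra_simps)
      then show ?case using Suc(2) inv(2) by fastforce }
  qed auto
  have lin: "bounded_linear (\<lambda>z. z \<bullet> v)" by (rule bounded_linear_inner_left)
  have "bounded ((\<lambda>z. z \<bullet> v) ` path_image \<delta>)"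
    using \<delta>(1) by (intro bounded_linear_image[OF _ lin] bounded_path_image)
  then obtain S where S: "S > 0" "\<And>z. z \<in> path_image \<delta> \<Longrightarrow> \<bar>z \<bullet> v\<bar> < S"
    unfolding bounded_pos_less by auto
  \<comment> \<open>The segment of the line from c - N v to c + N v has to extend beyond
    \<open>\<delta>\<close> at both ends in the direction of \<open>v\<close>.\<close>
  obtain N :: nat where N: "S + \<bar>c \<bullet> v\<bar> < real N * (v \<bullet> v)"
    using reals_Archimedean3[of "v \<bullet> v"] v by (metis inner_gt_zero_iff)
  then have "N \<noteq> 0" using S(1) by (cases "N = 0") auto
  then obtain n where n: "2 * N = Suc n" by (cases "2 * N") auto
  obtain g where g: "path g" "pathstart g = c" "pathfinish g = c + real (2 * N) *\<^sub>R v"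
    "path_image g \<subseteq> (\<Union>k::nat. (+) (real k *\<^sub>R v) ` path_image \<gamma>)"
    using translated_paths_join[OF \<gamma>(1,3), of n] n unfolding c_def by metis
  \<comment> \<open>Coordinates along and across \<open>v\<close> bring the crossing into the
    axis-parallel form of \<open>fashoda_clamped\<close>.\<close>
  define \<Phi> where "\<Phi> = (\<lambda>z::real^2. vector [z \<bullet> v, z \<bullet> rot90 v] :: real^2)"
  have "continuous_on UNIV \<Phi>"
    unfolding \<Phi>_def by (intro continuous_on_vector2 continuous_intros)
  then have cont: "continuous_on B \<Phi>" for B by (rule continuous_on_subset) auto
  define g' where "g' = (\<lambda>z. z - real N *\<^sub>R v) \<circ> g"
  have "path g'" unfolding g'_def
    by (intro path_continuous_image g continuous_intros)
  have gi: "z \<in> A \<and> L1 < z \<bullet> rot90 v \<and> z \<bullet> rot90 v < L2" if "z \<in> path_image g'" for z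
  proof -
    have "z + real N *\<^sub>R v \<in> path_image g" using that by (auto simp: g'_def path_image_compose)
    then have "z + real N *\<^sub>R v \<in> (\<Union>k::nat. (+) (real k *\<^sub>R v) ` path_image \<gamma>)" using g(4) by blast
    then obtain k w where w: "w \<in> path_image \<gamma>" "z + real N *\<^sub>R v = real k *\<^sub>R v + w" by blast
    then have z: "z = (w + real k *\<^sub>R v) - real N *\<^sub>R v" by (simp add: algebra_simps)
    have "w \<in> A" using w \<gamma> by blast
    then have "z \<in> A" using inv' unfolding z by blast
    moreover have "z \<bullet> rot90 v = w \<bullet> rot90 v" unfolding z by (simp add: inner_diff_left inner_add_left)
    ultimately show ?thesis using bd[OF w(1)] by simp
  qed
  have "L1 < L2" using bd[OF pathstart_in_path_image] by fastforce
  have "path_image (\<Phi> \<circ> g') \<inter> path_image (\<Phi> \<circ> \<delta>) \<noteq> {}"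
  proof (rule fashoda_clamped[OF _ _ S(1) \<open>L1 < L2\<close>])
    show "path (\<Phi> \<circ> g')" "path (\<Phi> \<circ> \<delta>)"
      using \<open>path g'\<close> \<delta>(1) cont by (auto intro!: path_continuous_image)
    show "pathstart (\<Phi> \<circ> g') $ 1 \<le> - S"
      using N by (simp add: pathstart_compose g'_def g \<Phi>_def inner_diff_left)
    show "pathfinish (\<Phi> \<circ> g') $ 1 \<ge> S"
      using N by (simp add: pathfinish_compose g'_def g \<Phi>_def inner_diff_left inner_add_left)
    show "L1 < z $ 2 \<and> z $ 2 < L2" if "z \<in> path_image (\<Phi> \<circ> g')" for z
      using that gi unfolding path_image_compose by (auto simp: \<Phi>_def)
    show "\<bar>z $ 1\<bar> < S" if "z \<in> path_image (\<Phi> \<circ> \<delta>)" for z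
      using that S(2) unfolding path_image_compose by (auto simp: \<Phi>_def)
  qed (use \<delta> in \<open>auto simp: pathstart_compose pathfinish_compose \<Phi>_def\<close>)
  then obtain p q where pq: "p \<in> path_image g'" "q \<in> path_image \<delta>" "\<Phi> p = \<Phi> q"
    unfolding path_image_compose by blast
  then have "p = q"
    using inner_rot90_inject[OF v, of p q] by (simp add: \<Phi>_def vec_eq_iff forall_2)
  then show ?thesis using pq gi by blast
qed

section \<open>Lifts of irrational pseudo-rotations\<close>

definition int_lattice :: "(real^2) set" where
  "int_lattice = {v. \<forall>i. v $ i \<in> \<int>}"

lemma int_lattice_minus: "u \<in> int_lattice \<Longrightarrow> - u \<in> int_lattice"
  by (simp add: int_lattice_def)

lemma int_lattice_diff: "u \<in> int_lattice \<Longrightarrow> v \<in> int_lattice \<Longrightarrow> u - v \<in> int_lattice"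
  by (simp add: int_lattice_def)

lemma int_lattice_scale_nat: "u \<in> int_lattice \<Longrightarrow> real k *\<^sub>R u \<in> int_lattice"
  by (simp add: int_lattice_def)

lemma int_lattice_rot90: "u \<in> int_lattice \<Longrightarrow> rot90 u \<in> int_lattice"
  by (simp add: int_lattice_def rot90_def forall_2)

lemma axis_int_lattice: "axis i 1 \<in> int_lattice"
  by (simp add: int_lattice_def axis_def)

lemma proj_torus_eq_iff: "proj_torus x = proj_torus y \<longleftrightarrow> x - y \<in> int_lattice"
  by (simp add: torus.abs_eq_iff lattice_equiv_def int_lattice_def)

lemma proj_torus_surj: "\<exists>z. t = proj_torus z"
  by (metis Quotient3_abs_rep Quotient3_torus)

lemma open_vimage_proj_torus: "open U \<Longrightarrow> open (proj_torus -` U)"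
  by (simp add: open_torus_def)

lemma open_image_proj_torus:
  assumes "open W"
  shows "open (proj_torus ` W)"
proof -
  have "proj_torus -` (proj_torus ` W) = (\<Union>v\<in>int_lattice. (+) v ` W)"
  proof (intro set_eqI iffI)
    fix z assume "z \<in> proj_torus -` (proj_torus ` W)"
    then obtain w where w: "w \<in> W" "proj_torus z = proj_torus w" by auto
    then have "z - w \<in> int_lattice" "z = (z - w) + w" by (auto simp: proj_torus_eq_iff)
    then show "z \<in> (\<Union>v\<in>int_lattice. (+) v ` W)" using w by blast
  next
    fix z assume "z \<in> (\<Union>v\<in>int_lattice. (+) v ` W)"
    then obtain v w where vw: "v \<in> int_lattice" "w \<in> W" "z = v + w" by blast
    then have "proj_torus z = proj_torus w" by (simp add: proj_torus_eq_iff)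
    then show "z \<in> proj_torus -` (proj_torus ` W)" using vw by auto
  qed
  then show ?thesis using assms by (auto simp: open_torus_def intro: open_translation)
qed

lemma totally_irrationalD:
  assumes "totally_irrational \<rho>" "a \<in> \<rat>" "b \<in> \<rat>" "c \<in> \<rat>" "a + b * \<rho> $ 1 + c * \<rho> $ 2 = 0"
  shows "b = 0" "c = 0"
proof -
  obtain a' b' c' where "a = of_rat a'" "b = of_rat b'" "c = of_rat c'"
    using assms(2-4) by (metis Rats_cases)
  then show "b = 0" "c = 0" using assms(1,5) unfolding totally_irrational_def by auto
qed

lemma int_lattice_imp_Rats: "v \<in> int_lattice \<Longrightarrow> v $ i \<in> \<rat>"
  using Ints_subset_Rats by (auto simp: int_lattice_def)

locale pseudo_rotation_lift =
  fixes f :: "torus \<Rightarrow> torus" and F :: "real^2 \<Rightarrow> real^2" and \<rho> :: "real^2"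
  assumes irr: "totally_irrational \<rho>" and contF: "continuous_on UNIV F"
    and lift: "proj_torus (F z) = f (proj_torus z)"
    and rot: "(\<lambda>n. ((F ^^ n) z - z) /\<^sub>R real n) \<longlonglongrightarrow> \<rho>"
    and bij_f: "bij f" and nw: "non_wandering f"
begin

text \<open>The increment of \<open>F\<close> over a lattice vector is continuous in z and has
  integer coordinates, hence is constant.\<close>

lemma lift_translate_ex:
  assumes "w \<in> int_lattice"
  shows "\<exists>a\<in>int_lattice. \<forall>z. F (z + w) = F z + a"
proof -
  define d where "d = (\<lambda>z. F (z + w) - F z)"
  have dl: "d z \<in> int_lattice" for z
  proof -
    have "proj_torus (z + w) = proj_torus z" using assms by (simp add: proj_torus_eq_iff)
    then show ?thesis unfolding d_def by (simp add: proj_torus_eq_iff[symmetric] lift)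
  qed
  have contd: "continuous_on UNIV (\<lambda>z. d z $ i)" for i unfolding d_def
    by (intro continuous_intros continuous_on_compose2[OF contF]) auto
  have "\<exists>e>0. \<forall>y. y \<in> UNIV \<and> d y $ i \<noteq> d x $ i \<longrightarrow> e \<le> norm (d y $ i - d x $ i)" for x i
  proof (intro exI[of _ 1] conjI allI impI)
    fix y assume y: "y \<in> UNIV \<and> d y $ i \<noteq> d x $ i"
    have "d y $ i - d x $ i \<in> \<int>" using dl unfolding int_lattice_def by auto
    then show "1 \<le> norm (d y $ i - d x $ i)" using y Ints_nonzero_abs_ge1[of "d y $ i - d x $ i"] by simp
  qed simp
  then have "(\<lambda>z. d z $ i) constant_on UNIV" for i
    by (rule continuous_discrete_range_constant[OF connected_UNIV contd])
  then have "\<And>z i. d z $ i = d 0 $ i" unfolding constant_on_def by (metis UNIV_I)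
  then have "\<And>z. d z = d 0" by (simp add: vec_eq_iff)
  then show ?thesis using dl by (intro bexI[of _ "d 0"]) (simp_all add: d_def diff_eq_eq add.commute)
qed

text \<open>The integer matrix by which \<open>F\<close> acts on the lattice fixes \<open>\<rho>\<close>, and total irrationality
  of \<open>\<rho>\<close> forces it to be the identity.\<close>

lemma lift_add_bounded:
  shows lift_add: "v \<in> int_lattice \<Longrightarrow> F (z + v) = F z + v"
    and lift_bounded: "bounded (range (\<lambda>z. F z - z))"
proof -
  obtain a1 where a1: "a1 \<in> int_lattice" "\<And>z. F (z + axis 1 1) = F z + a1"
    using lift_translate_ex axis_int_lattice by blast
  obtain a2 where a2: "a2 \<in> int_lattice" "\<And>z. F (z + axis 2 1) = F z + a2"
    using lift_translate_ex axis_int_lattice by blast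
  define A where "A = (\<lambda>z::real^2. z $ 1 *\<^sub>R a1 + z $ 2 *\<^sub>R a2)"
  \<comment> \<open>Subtracting the linear map with columns \<open>a1\<close> and \<open>a2\<close>
    leaves a lattice-periodic, hence bounded, remainder.\<close>
  define E where "E = (\<lambda>z. F z - A z)"
  have E1: "E (z + axis 1 1) = E z" "E (z + axis 2 1) = E z" for z
    unfolding E_def A_def a1 a2 by (simp_all add: axis_def algebra_simps)
  have E2: "E (z + of_int n *\<^sub>R axis i 1) = E z" for n z i
  proof (induction n rule: int_induct[of _ 0])
    case (step1 n)
    have "E (z + of_int n *\<^sub>R axis i 1 + axis i 1) = E z"
      using E1[of "z + of_int n *\<^sub>R axis i 1"] step1 exhaust_2[of i] by auto
    then show ?case by (simp add: algebra_simps)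
  next
    case (step2 n)
    have "E (z + of_int (n - 1) *\<^sub>R axis i 1 + axis i 1) = E (z + of_int (n - 1) *\<^sub>R axis i 1)"
      using E1[of "z + of_int (n - 1) *\<^sub>R axis i 1"] exhaust_2[of i] by auto
    then show ?case using step2 by (simp add: algebra_simps)
  qed simp
  have Eper: "E (z + v) = E z" if "v \<in> int_lattice" for z v
  proof -
    obtain m n where mn: "v $ 1 = of_int m" "v $ 2 = of_int n"
      using \<open>v \<in> int_lattice\<close> unfolding int_lattice_def by (metis Ints_cases mem_Collect_eq)
    have "v = of_int m *\<^sub>R axis 1 1 + of_int n *\<^sub>R axis 2 1"
      using mn by (simp add: vec_eq_iff forall_2 axis_def)
    then have "z + v = (z + of_int m *\<^sub>R axis 1 1) + of_int n *\<^sub>R axis 2 1" by simp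
    then show ?thesis by (simp only: E2)
  qed
  have contA: "continuous_on S A" for S unfolding A_def by (intro continuous_intros)
  have "continuous_on S E" for S unfolding E_def
    by (intro continuous_intros contA continuous_on_subset[OF contF]) auto
  then have "bounded (E ` cbox 0 1)"
    by (intro compact_imp_bounded compact_continuous_image compact_cbox)
  moreover have "range E \<subseteq> E ` cbox 0 1"
  proof
    fix w assume "w \<in> range E"
    then obtain z where z: "w = E z" by blast
    define v where "v = ((\<chi> i. of_int \<lfloor>z $ i\<rfloor>) :: real^2)"
    have "v \<in> int_lattice" by (simp add: v_def int_lattice_def)
    then have "E (z - v) = w" using Eper[of v "z - v"] z by simp
    moreover have "z - v \<in> cbox 0 1" by (auto simp: mem_box_cart v_def) linarith+
    ultimately show "w \<in> E ` cbox 0 1" by blast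
  qed
  ultimately have bdE: "bounded (range E)" by (rule bounded_subset)
  obtain b where b: "\<And>z. norm (E z) \<le> b" using bdE unfolding bounded_iff by auto
  \<comment> \<open>The orbit of 0 satisfies x (n + 1) = A (x n) + E (x n). After division by n + 1
    the bounded term disappears and the limit reads \<rho> = A \<rho>.\<close>
  define x where "x = (\<lambda>n. (F ^^ n) 0)"
  have xr: "(\<lambda>n. x n /\<^sub>R real n) \<longlonglongrightarrow> \<rho>" using rot[of 0] by (simp add: x_def)
  have eq: "x (Suc n) /\<^sub>R real (Suc n) = (real n / real (Suc n)) *\<^sub>R A (x n /\<^sub>R real n) + E (x n) /\<^sub>R real (Suc n)" for n
  proof (cases "n = 0")
    case False
    have "x (Suc n) = A (x n) + E (x n)" by (simp add: E_def x_def)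
    moreover have "A (x n /\<^sub>R real n) = A (x n) /\<^sub>R real n" by (simp add: A_def algebra_simps)
    ultimately show ?thesis using False by (simp add: scaleR_add_right divide_inverse)
  qed (simp add: x_def E_def A_def)
  have "(\<lambda>n. (real n / real (Suc n)) *\<^sub>R A (x n /\<^sub>R real n) + E (x n) /\<^sub>R real (Suc n)) \<longlonglongrightarrow> 1 *\<^sub>R A \<rho> + 0"
  proof (intro tendsto_intros LIMSEQ_n_over_Suc_n)
    show "(\<lambda>n. A (x n /\<^sub>R real n)) \<longlonglongrightarrow> A \<rho>"
      using contA[of UNIV] xr by (auto simp: continuous_on_def intro: tendsto_compose)
    have "(\<lambda>n. inverse (real (Suc n)) *\<^sub>R E (x n)) \<longlonglongrightarrow> 0"
    proof (rule lim_null_scaleR_bounded[OF LIMSEQ_inverse_real_of_nat])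
      show "\<forall>\<^sub>F n in sequentially. inverse (real (Suc n)) = 0 \<or> norm (E (x n)) \<le> b"
        using b by simp
    qed
    then show "(\<lambda>n. E (x n) /\<^sub>R real (Suc n)) \<longlonglongrightarrow> 0" .
  qed
  moreover have "(\<lambda>n. x (Suc n) /\<^sub>R real (Suc n)) \<longlonglongrightarrow> \<rho>" using LIMSEQ_Suc[OF xr] .
  ultimately have A\<rho>: "A \<rho> = \<rho>" unfolding eq[symmetric] using LIMSEQ_unique by fastforce
  have R: "a1 $ i \<in> \<rat>" "a2 $ i \<in> \<rat>" for i using a1 a2 int_lattice_imp_Rats by auto
  have "0 + (a1 $ 1 - 1) * \<rho> $ 1 + a2 $ 1 * \<rho> $ 2 = 0" "0 + a1 $ 2 * \<rho> $ 1 + (a2 $ 2 - 1) * \<rho> $ 2 = 0"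
    using A\<rho> by (auto simp: A_def vec_eq_iff forall_2 algebra_simps)
  then have "a1 $ 1 - 1 = 0" "a2 $ 1 = 0" "a1 $ 2 = 0" "a2 $ 2 - 1 = 0"
    using totally_irrationalD[OF irr Rats_0] Rats_diff[OF R(1) Rats_1] Rats_diff[OF R(2) Rats_1] R
    by metis+
  then have Aid: "A z = z" for z by (simp add: A_def vec_eq_iff forall_2)
  show "F (z + v) = F z + v" if "v \<in> int_lattice"
    using Eper[OF that, of z] by (simp add: E_def Aid algebra_simps)
  show "bounded (range (\<lambda>z. F z - z))" using bdE by (simp add: E_def Aid)
qed

lemma funpow_lift: "proj_torus ((F ^^ n) z) = (f ^^ n) (proj_torus z)"
  by (induction n) (auto simp: lift)

lemma funpow_lift_add: "v \<in> int_lattice \<Longrightarrow> (F ^^ n) (z + v) = (F ^^ n) z + v"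
  by (induction n) (auto simp: lift_add)

lemma funpow_lift_diff: "v \<in> int_lattice \<Longrightarrow> (F ^^ n) (z - v) = (F ^^ n) z - v"
  using funpow_lift_add[OF int_lattice_minus, of v n z] by simp

lemma inj_lift: "inj F"
proof (rule injI)
  fix x y assume xy: "F x = F y"
  then have "f (proj_torus x) = f (proj_torus y)" by (simp add: lift[symmetric])
  then have "x - y \<in> int_lattice" using bij_f by (simp add: bij_is_inj inj_eq proj_torus_eq_iff)
  then show "x = y" using lift_add[of "x - y" y] xy by simp
qed

lemma inj_funpow_lift: "inj (F ^^ n)"
  using inj_lift by (rule inj_fn)

lemma continuous_funpow_lift: "continuous_on S (F ^^ n)"
  using continuous_on_UNIV_funpow[OF contF] continuous_on_subset by blast

lemma open_image_funpow_lift: "open W \<Longrightarrow> open ((F ^^ n) ` W)"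
  by (rule invariance_of_domain[OF continuous_funpow_lift]) (auto intro: inj_on_subset[OF inj_funpow_lift])

lemma open_vimage_funpow_lift: "open W \<Longrightarrow> open ((F ^^ n) -` W)"
  by (rule open_vimage[OF _ continuous_funpow_lift])

lemma bounded_funpow_lift: "bounded (range (\<lambda>z. (F ^^ n) z - z))"
proof (induction n)
  case (Suc n)
  then obtain a b where "\<And>z. norm ((F ^^ n) z - z) \<le> a" "\<And>z. norm (F z - z) \<le> b"
    using lift_bounded unfolding bounded_iff by auto
  then have "norm ((F ^^ Suc n) z - z) \<le> b + a" for z
    using norm_triangle_ineq[of "F ((F ^^ n) z) - (F ^^ n) z" "(F ^^ n) z - z"]
    by (simp add: add_mono order_trans)
  then show ?case unfolding bounded_iff by blast
qed (simp add: image_constant_conv)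

lemma funpow_lift_shift:
  assumes "w \<in> int_lattice"
  shows "((\<lambda>y. (F ^^ n) y - w) ^^ q) z = (F ^^ (n * q)) z - real q *\<^sub>R w"
proof (induction q)
  case (Suc q)
  have "((\<lambda>y. (F ^^ n) y - w) ^^ Suc q) z = (F ^^ n) ((F ^^ (n * q)) z) - real q *\<^sub>R w - w"
    using Suc funpow_lift_diff[OF int_lattice_scale_nat[OF assms]] by simp
  also have "\<dots> = (F ^^ (n * Suc q)) z - real (Suc q) *\<^sub>R w"
    by (simp add: funpow_add algebra_simps)
  finally show ?case .
qed simp

text \<open>With T = F^n - w one has T^k z = F^(nk) z - k w. If its product with \<open>v\<close>
  stays bounded, division by nk gives \<rho> \<bullet> v = (w \<bullet> v) / n, a rational relation
  with coefficients from \<open>v\<close>.\<close>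

lemma no_bounded_rational_direction:
  assumes "n \<ge> 1" "w \<in> int_lattice" "v \<in> int_lattice"
    and bd: "\<And>k. \<bar>(((\<lambda>y. (F ^^ n) y - w) ^^ k) z) \<bullet> v\<bar> \<le> b"
  shows "v = 0"
proof -
  have sm: "strict_mono (\<lambda>k. n * k)" using assms(1) by (simp add: strict_mono_def)
  have "(\<lambda>k. ((F ^^ (n * k)) z - z) /\<^sub>R real (n * k)) \<longlonglongrightarrow> \<rho>"
    using LIMSEQ_subseq_LIMSEQ[OF rot sm] by (simp add: o_def)
  then have "(\<lambda>k. (((F ^^ (n * k)) z - z) /\<^sub>R real (n * k)) \<bullet> v) \<longlonglongrightarrow> \<rho> \<bullet> v"
    by (intro tendsto_intros)
  \<comment> \<open>The index starts at 1 because division by 0 at k = 0 would break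
    \<open>eq\<close>.\<close>
  then have l1: "(\<lambda>k. (((F ^^ (n * Suc k)) z - z) /\<^sub>R real (n * Suc k)) \<bullet> v) \<longlonglongrightarrow> \<rho> \<bullet> v"
    by (rule LIMSEQ_Suc)
  define c where "c = (\<lambda>k. (((\<lambda>y. (F ^^ n) y - w) ^^ k) z - z) \<bullet> v)"
  have eq: "(((F ^^ (n * Suc k)) z - z) /\<^sub>R real (n * Suc k)) \<bullet> v
      = inverse (real (Suc k)) *\<^sub>R (c (Suc k) / n) + (w \<bullet> v) / n" for k
    using assms(1) unfolding c_def funpow_lift_shift[OF assms(2)]
    by (simp add: inner_diff_left inner_add_left field_simps del: of_nat_Suc funpow.simps mult_Suc_right)
  have "(\<lambda>k. inverse (real (Suc k)) *\<^sub>R (c (Suc k) / n) + (w \<bullet> v) / n) \<longlonglongrightarrow> 0 + (w \<bullet> v) / n"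
  proof (intro tendsto_intros lim_null_scaleR_bounded[OF LIMSEQ_inverse_real_of_nat])
    have "norm (c (Suc k) / n) \<le> (b + \<bar>z \<bullet> v\<bar>) / n" for k
      using bd[of "Suc k"] assms(1) unfolding c_def inner_diff_left
      by (simp add: divide_right_mono del: funpow.simps)
    then show "\<forall>\<^sub>F k in sequentially. inverse (real (Suc k)) = 0 \<or> norm (c (Suc k) / n) \<le> (b + \<bar>z \<bullet> v\<bar>) / n"
      by simp
  qed
  then have "\<rho> \<bullet> v = (w \<bullet> v) / n" using l1 unfolding eq using LIMSEQ_unique by fastforce
  then have *: "- ((w \<bullet> v) / n) + v $ 1 * \<rho> $ 1 + v $ 2 * \<rho> $ 2 = 0"
    by (simp add: inner_vec_def sum_2 mult.commute)
  have "- ((w \<bullet> v) / n) \<in> \<rat>"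
    using assms(2,3) by (auto simp: inner_vec_def sum_2 intro!: Rats_add Rats_mult Rats_divide int_lattice_imp_Rats)
  from totally_irrationalD[OF irr this _ _ *] assms(3)
  show "v = 0" by (simp add: vec_eq_iff forall_2 int_lattice_imp_Rats)
qed

lemma no_rational_periodic_point:
  assumes "n \<ge> 1" "w \<in> int_lattice"
  shows "(F ^^ n) z - w \<noteq> z"
proof
  assume "(F ^^ n) z - w = z"
  then have "((\<lambda>y. (F ^^ n) y - w) ^^ k) z = z" for k by (induction k) auto
  then have "axis 1 1 = (0 :: real^2)"
    using no_bounded_rational_direction[OF assms axis_int_lattice[of 1], of z "\<bar>z \<bullet> axis 1 1\<bar>"] by simp
  then show False by (simp add: axis_eq_0_iff)
qed

text \<open>Recurrence is available only on the torus: the orbit comes back to an integer translate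
  of \<open>W\<close>, and \<open>u\<close> records which one.\<close>

lemma lifted_return:
  assumes "open W" "W \<noteq> {}"
  obtains m u z where "m \<ge> 1" "u \<in> int_lattice" "z \<in> W" "(F ^^ m) z - u \<in> W"
proof -
  have "open (proj_torus ` W)" "proj_torus ` W \<noteq> {}" using assms open_image_proj_torus by auto
  then obtain m where m: "m \<ge> 1" "(f ^^ m) ` proj_torus ` W \<inter> proj_torus ` W \<noteq> {}"
    using nw unfolding non_wandering_def by blast
  then obtain z z' where z: "z \<in> W" "z' \<in> W" "(f ^^ m) (proj_torus z) = proj_torus z'" by auto
  then have "(F ^^ m) z - z' \<in> int_lattice" by (simp add: funpow_lift[symmetric] proj_torus_eq_iff)
  then show thesis using that[OF m(1) _ z(1), of "(F ^^ m) z - z'"] z by simp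
qed

section \<open>Components of invariant open sets\<close>

definition invariant_open :: "(real^2) set \<Rightarrow> bool" where
  "invariant_open P \<longleftrightarrow> open P \<and> (\<forall>z\<in>P. F z \<in> P) \<and> (\<forall>z\<in>P. \<forall>u\<in>int_lattice. z + u \<in> P)"

text \<open>The image of \<open>C\<close> is connected and stays in \<open>P\<close>, so once it
  meets \<open>C\<close> it lies in \<open>C\<close>. The case m = 0 covers lattice
  translations.\<close>

lemma component_return_invariant:
  assumes P: "invariant_open P" "C \<in> components P" and u: "u \<in> int_lattice"
    and z: "z \<in> C" "(F ^^ m) z - u \<in> C" and y: "y \<in> C"
  shows "(F ^^ m) y - u \<in> C"
proof -
  have "(F ^^ m) x \<in> P" if "x \<in> P" for x
    using that P(1) by (induction m) (auto simp: invariant_open_def)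
  then have "(\<lambda>x. (F ^^ m) x - u) ` P \<subseteq> P"
    using P(1) int_lattice_minus[OF u] unfolding invariant_open_def by fastforce
  then have "(\<lambda>x. (F ^^ m) x - u) ` C \<subseteq> P" using in_components_subset[OF P(2)] by blast
  moreover have "connected ((\<lambda>x. (F ^^ m) x - u) ` C)"
    by (intro connected_continuous_image continuous_intros continuous_funpow_lift in_components_connected[OF P(2)])
  moreover have "C \<inter> (\<lambda>x. (F ^^ m) x - u) ` C \<noteq> {}" using z by blast
  ultimately show ?thesis using components_maximal[OF P(2)] y by blast
qed

lemma component_translation_invariant:
  assumes "invariant_open P" "C \<in> components P" "u \<in> int_lattice" "z \<in> C" "z + u \<in> C" "y \<in> C"
  shows "y + u \<in> C"
  using component_return_invariant[OF assms(1,2) int_lattice_minus[OF assms(3)], of z 0 y] assms by simp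

lemma component_returns:
  assumes P: "invariant_open P" "C \<in> components P"
  shows "\<exists>n\<ge>1. \<exists>w\<in>int_lattice. \<forall>y\<in>C. (F ^^ n) y - w \<in> C"
proof -
  have "open C" "C \<noteq> {}"
    using P open_components in_components_nonempty unfolding invariant_open_def by auto
  then obtain m u z where "m \<ge> 1" "u \<in> int_lattice" "z \<in> C" "(F ^^ m) z - u \<in> C"
    using lifted_return by metis
  then show ?thesis using component_return_invariant[OF P] by blast
qed

text \<open>Otherwise the return map of the component, which has no fixed point, would have a
  free ball returning to itself.\<close>

lemma component_has_period:
  assumes P: "invariant_open P" "C \<in> components P"
  shows "\<exists>v\<in>int_lattice. v \<noteq> 0 \<and> (\<forall>y\<in>C. y + v \<in> C)"
proof (rule ccontr)
  assume contra: "\<not> ?thesis"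
  have triv: "u = 0" if "u \<in> int_lattice" "y \<in> C" "y + u \<in> C" for u y
    using that contra component_translation_invariant[OF P that(1)] by blast
  have C: "open C" "C \<noteq> {}"
    using P open_components in_components_nonempty unfolding invariant_open_def by auto
  define R where "R = (\<lambda>n. n \<ge> 1 \<and> (\<exists>w\<in>int_lattice. \<forall>y\<in>C. (F ^^ n) y - w \<in> C))"
  define n where "n = (LEAST n. R n)"
  have "\<exists>n. R n" using component_returns[OF P] by (auto simp: R_def)
  then have "R n" unfolding n_def by (rule LeastI_ex)
  then obtain w where w: "n \<ge> 1" "w \<in> int_lattice" "\<And>y. y \<in> C \<Longrightarrow> (F ^^ n) y - w \<in> C"
    by (auto simp: R_def)
  define T where "T = (\<lambda>y. (F ^^ n) y - w)"
  have TC: "(T ^^ q) y \<in> C" if "y \<in> C" for q y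
    using that w(3) by (induction q) (auto simp: T_def)
  \<comment> \<open>The Brouwer theory above lives on \<open>complex\<close>, where difference
    quotients make sense; \<open>jc\<close> and \<open>jr\<close> carry \<open>T\<close>
    there.\<close>
  define jc where "jc = (\<lambda>z::real^2. Complex (z $ 1) (z $ 2))"
  define jr where "jr = (\<lambda>c. vector [Re c, Im c] :: real^2)"
  have j: "jc (jr c) = c" "jr (jc z) = z" for c z
    by (simp_all add: jc_def jr_def vec_eq_iff forall_2)
  have cj: "continuous_on S jc" "continuous_on S' jr" for S S'
    unfolding jc_def jr_def Complex_eq by (intro continuous_intros continuous_on_vector2)+
  define G where "G = jc \<circ> T \<circ> jr"
  have Gk: "(G ^^ k) (jc z) = jc ((T ^^ k) z)" for k z
    by (induction k) (simp_all add: G_def j)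
  have "plane_shift G" unfolding plane_shift_def
  proof (intro conjI allI)
    have cT: "continuous_on S T" for S unfolding T_def by (intro continuous_intros continuous_funpow_lift)
    show "continuous_on UNIV G" unfolding G_def
      by (intro continuous_on_compose cj cT)
    have "inj T" using inj_funpow_lift[of n] by (auto simp: T_def inj_def)
    then show "inj G" unfolding G_def inj_def comp_apply by (metis j)
    obtain b where b: "\<And>z. norm ((F ^^ n) z - z) \<le> b"
      using bounded_funpow_lift[of n] unfolding bounded_iff by auto
    have jcn: "norm (jc x) = norm x" for x
      by (simp add: jc_def cmod_def norm_vec_def L2_set_def sum_2)
    have "norm (G c - c) \<le> b + norm w" for c
    proof -
      have "G c - c = jc ((F ^^ n) (jr c) - jr c - w)"
        by (simp add: G_def T_def jc_def jr_def complex_eq_iff)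
      then have "norm (G c - c) = norm ((F ^^ n) (jr c) - jr c - w)" by (simp only: jcn)
      also have "\<dots> \<le> norm ((F ^^ n) (jr c) - jr c) + norm w" by (rule norm_triangle_ineq4)
      finally show ?thesis using b[of "jr c"] by simp
    qed
    then show "bounded (range (\<lambda>z. G z - z))" unfolding bounded_iff by blast
    show "G c \<noteq> c" for c
    proof
      assume "G c = c"
      then have "T (jr c) = jr c" unfolding G_def comp_apply by (metis j)
      then show False using no_rational_periodic_point[OF w(1,2)] by (simp add: T_def)
    qed
  qed
  obtain c where c: "c \<in> C" using C by blast
  have "open (jr -` C)" by (rule open_vimage[OF C(1) cj(2)])
  moreover have "jc c \<in> jr -` C" using c by (simp add: j)
  ultimately obtain e where e: "e > 0" "ball (jc c) e \<subseteq> jr -` C" "G ` ball (jc c) e \<inter> ball (jc c) e = {}"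
    using free_small_ball[OF \<open>plane_shift G\<close>] by metis
  define W where "W = jc -` ball (jc c) e"
  have "open W" unfolding W_def by (intro open_vimage cj open_ball)
  moreover have "c \<in> W" using e(1) by (simp add: W_def)
  ultimately have W: "open W" "W \<noteq> {}" by auto
  have WC: "W \<subseteq> C" using e(2) j unfolding W_def by (metis subsetI subsetD vimageE vimageI2)
  obtain m u z where m: "m \<ge> 1" "u \<in> int_lattice" "z \<in> W" "(F ^^ m) z - u \<in> W"
    using lifted_return[OF W] by metis
  \<comment> \<open>Division with remainder splits off \<open>q\<close> steps of \<open>T\<close>.
    What is left is a return of \<open>C\<close> at time r < n, so minimality of \<open>n\<close>
    gives r = 0.\<close>
  define q where "q = m div n"
  define r where "r = m mod n"
  have mqr: "m = r + n * q" by (simp add: q_def r_def)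
  have zC: "z \<in> C" using m WC by blast
  have Tq: "(T ^^ q) z = (F ^^ (n * q)) z - real q *\<^sub>R w"
    unfolding T_def by (rule funpow_lift_shift[OF w(2)])
  define u' where "u' = u - real q *\<^sub>R w"
  have u': "u' \<in> int_lattice" unfolding u'_def
    by (intro int_lattice_diff int_lattice_scale_nat m w)
  have "(F ^^ m) z - u = (F ^^ r) ((T ^^ q) z + real q *\<^sub>R w) - u"
    unfolding Tq mqr funpow_add by simp
  also have "\<dots> = (F ^^ r) ((T ^^ q) z) - u'"
    using funpow_lift_add[OF int_lattice_scale_nat[OF w(2)]] by (simp add: u'_def)
  finally have Fr: "(F ^^ m) z - u = (F ^^ r) ((T ^^ q) z) - u'" .
  have "(F ^^ r) ((T ^^ q) z) - u' \<in> C" using m(4) WC Fr by auto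
  then have inv: "(F ^^ r) y - u' \<in> C" if "y \<in> C" for y
    using component_return_invariant[OF P u' TC[OF zC, of q]] that by blast
  have "r = 0"
  proof (rule ccontr)
    assume "r \<noteq> 0"
    then have "R r" using inv u' by (auto simp: R_def)
    then have "n \<le> r" unfolding n_def by (rule Least_le)
    moreover have "r < n" using w(1) unfolding r_def by (intro mod_less_divisor) simp
    ultimately show False by simp
  qed
  \<comment> \<open>For r = 0 the remaining return is a pure translation of \<open>C\<close>, which
    is trivial by assumption. So \<open>T^q\<close> itself brings z back to the free ball.\<close>
  then have "u' = 0"
    using triv[OF int_lattice_minus[OF u'] zC] inv[OF zC] by simp
  then have "(T ^^ q) z \<in> W" using Fr m(4) \<open>r = 0\<close> by simp
  then have "(G ^^ q) (jc z) \<in> ball (jc c) e" unfolding Gk by (simp add: W_def)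
  moreover have "jc z \<in> ball (jc c) e" using m(3) by (simp add: W_def)
  moreover have "q \<ge> 1" using m(1) mqr \<open>r = 0\<close> by (cases q) auto
  ultimately show False
    using brouwer_free_no_return[OF \<open>plane_shift G\<close> open_ball connected_ball e(3)] by blast
qed

lemma invariant_open_sets_meet:
  assumes P: "invariant_open P" "P \<noteq> {}" and Q: "invariant_open Q" "Q \<noteq> {}"
  shows "P \<inter> Q \<noteq> {}"
proof
  assume disj: "P \<inter> Q = {}"
  obtain C where C: "C \<in> components P" using P(2) components_eq_empty by blast
  obtain D where D: "D \<in> components Q" using Q(2) components_eq_empty by blast
  have op: "open C" "open D" "C \<noteq> {}" "D \<noteq> {}"
    using P Q C D open_components in_components_nonempty unfolding invariant_open_def by auto
  then have pc: "path_connected C" "path_connected D"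
    using in_components_connected[OF C] in_components_connected[OF D]
    by (auto simp: connected_open_path_connected)
  obtain v where v: "v \<in> int_lattice" "v \<noteq> 0" "\<And>y. y \<in> C \<Longrightarrow> y + v \<in> C"
    using component_has_period[OF P(1) C] by blast
  obtain n w where w: "n \<ge> 1" "w \<in> int_lattice" "\<And>y. y \<in> D \<Longrightarrow> (F ^^ n) y - w \<in> D"
    using component_returns[OF Q(1) D] by blast
  obtain c where c: "c \<in> C" using op by blast
  have v': "y + - v \<in> C" if "y \<in> C" for y
    using component_translation_invariant[OF P(1) C int_lattice_minus[OF v(1)], of "c + v" y] that c v(3) by simp
  obtain \<gamma> where \<gamma>: "path \<gamma>" "path_image \<gamma> \<subseteq> C" "pathstart \<gamma> = c" "pathfinish \<gamma> = c + v"
    using pc(1) c v(3) unfolding path_connected_def by metis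
  define l where "l = (\<lambda>z. z \<bullet> rot90 v)"
  have "bounded (l ` path_image \<gamma>)" unfolding l_def
    using \<gamma>(1) by (intro bounded_linear_image[OF _ bounded_linear_inner_left] bounded_path_image)
  then obtain M where M: "M > 0" "\<And>z. z \<in> path_image \<gamma> \<Longrightarrow> \<bar>l z\<bar> < M"
    unfolding bounded_pos_less by auto
  \<comment> \<open>A path in \<open>D\<close> from one side to the other of a translated periodic
    line would meet that line, which lies in \<open>P\<close>.\<close>
  have cross: False if e: "e \<in> int_lattice" and ab: "a \<in> D" "b \<in> D" "l a \<le> l e - M" "l b \<ge> l e + M" for e a b
  proof -
    obtain \<delta> where \<delta>: "path \<delta>" "path_image \<delta> \<subseteq> D" "pathstart \<delta> = a" "pathfinish \<delta> = b"
      using pc(2) ab unfolding path_connected_def by metis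
    have "(+) e ` C \<inter> path_image \<delta> \<noteq> {}"
    proof (rule periodic_set_meets_crossing_path[OF v(2), where \<gamma> = "(+) e \<circ> \<gamma>"])
      show "(+) v ` (+) e ` C \<subseteq> (+) e ` C"
        using v(3) by (auto simp: image_iff algebra_simps)
      show "(+) (- v) ` (+) e ` C \<subseteq> (+) e ` C"
      proof clarify
        fix y assume "y \<in> C"
        then have "e + (y + - v) \<in> (+) e ` C" using v' by blast
        then show "- v + (e + y) \<in> (+) e ` C" by (simp add: algebra_simps)
      qed
      show "path ((+) e \<circ> \<gamma>)" "path_image ((+) e \<circ> \<gamma>) \<subseteq> (+) e ` C"
        using \<gamma> by (auto simp: path_translation_eq path_image_translation)
      show "pathfinish ((+) e \<circ> \<gamma>) = pathstart ((+) e \<circ> \<gamma>) + v"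
        using \<gamma> by (simp add: pathstart_translation pathfinish_translation)
      show "l e - M < z \<bullet> rot90 v \<and> z \<bullet> rot90 v < l e + M" if z: "z \<in> path_image ((+) e \<circ> \<gamma>)" for z
      proof -
        obtain y where "y \<in> path_image \<gamma>" "z = e + y" using z by (auto simp: path_image_translation)
        then show ?thesis using M(2)[of y] by (auto simp: l_def inner_add_left)
      qed
    qed (use \<delta> ab in \<open>auto simp: l_def\<close>)
    moreover have "(+) e ` C \<subseteq> P"
      using in_components_subset[OF C] P(1) e unfolding invariant_open_def by (auto simp: add.commute[of e])
    moreover have "path_image \<delta> \<subseteq> Q" using \<delta> in_components_subset[OF D] by blast
    ultimately show False using disj by blast
  qed
  obtain z0 where z0: "z0 \<in> D" using op by blast
  have "v \<bullet> v > 0" using v by simp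
  \<comment> \<open>Moving the line by \<plusminus>J \<open>rot90 v\<close> shifts \<open>l\<close>
    by \<plusminus>J (v \<bullet> v); this J places \<open>z0\<close> strictly between the two
    translates.\<close>
  then obtain J :: nat where J: "M + \<bar>l z0\<bar> < real J * (v \<bullet> v)"
    using reals_Archimedean3 by blast
  define e where "e = real J *\<^sub>R rot90 v"
  have e: "e \<in> int_lattice" "- e \<in> int_lattice" "l e = real J * (v \<bullet> v)" "l (- e) = - (real J * (v \<bullet> v))"
    using v(1) by (auto simp: e_def l_def rot90_inner_rot90 intro!: int_lattice_minus int_lattice_scale_nat int_lattice_rot90)
  have "\<bar>l b\<bar> \<le> M + real J * (v \<bullet> v)" if "b \<in> D" for b
  proof -
    have "l z0 \<le> l e - M" "l z0 \<ge> l (- e) + M" using J e by linarith+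
    then have "\<not> l e + M \<le> l b" "\<not> l b \<le> l (- e) - M"
      using cross[OF e(1) z0 that] cross[OF e(2) that z0] by blast+
    then have "l b \<le> M + real J * (v \<bullet> v)" "- l b \<le> M + real J * (v \<bullet> v)"
      using e by linarith+
    then show ?thesis by linarith
  qed
  moreover have "((\<lambda>y. (F ^^ n) y - w) ^^ k) z0 \<in> D" for k
    using z0 w(3) by (induction k) auto
  \<comment> \<open>The orbit of \<open>z0\<close> under the return map of \<open>D\<close> never
    leaves the strip, so it is bounded in the lattice direction \<open>rot90 v\<close>.\<close>
  ultimately have "rot90 v = 0"
    using no_bounded_rational_direction[OF w(1,2) int_lattice_rot90[OF v(1)], of z0] unfolding l_def by blast
  then show False using \<open>v \<bullet> v > 0\<close> by (metis inner_zero_left less_irrefl rot90_inner_rot90)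
qed

end

section \<open>Return to the torus\<close>

text \<open>Injectivity cancels the common iterates. The sign of m - k decides whether the rest is
  an iterate of \<open>f\<close> or of its inverse.\<close>

lemma int_iterate_eqI:
  assumes f: "bij f" and eq: "(f ^^ m) u = (f ^^ k) v"
  shows "int_iterate f (int m - int k) u = v"
proof (cases "k \<le> m")
  case True
  have "(f ^^ k) ((f ^^ (m - k)) u) = (f ^^ k) v"
    using eq True funpow_add[of k "m - k" f] by simp
  then have "(f ^^ (m - k)) u = v"
    using inj_fn[OF bij_is_inj[OF f], of k] by (auto dest: injD)
  then show ?thesis using True by (simp add: int_iterate_def nat_diff_distrib')
next
  case False
  have inv: "(inv f ^^ j) ((f ^^ j) v) = v" for j
  proof (induction j)
    case (Suc j)
    have "(inv f ^^ Suc j) ((f ^^ Suc j) v) = (inv f ^^ j) (inv f (f ((f ^^ j) v)))"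
      by (simp add: funpow_swap1)
    then show ?case using Suc f by (simp add: bij_is_inj)
  qed auto
  have "(f ^^ m) u = (f ^^ m) ((f ^^ (k - m)) v)"
    using eq False funpow_add[of m "k - m" f] by simp
  then have "u = (f ^^ (k - m)) v"
    using inj_fn[OF bij_is_inj[OF f], of m] by (auto dest: injD)
  then have "(inv f ^^ (k - m)) u = v" using inv by simp
  moreover have "nat (int k - int m) = k - m" by simp
  ultimately show ?thesis using False by (simp add: int_iterate_def)
qed

theorem corollaryE:
  fixes f :: "torus \<Rightarrow> torus"
  assumes "\<exists>g. homeomorphism UNIV UNIV f g"
    and "homotopic_with_canon (\<lambda>_. True) UNIV UNIV f id"
    and "non_wandering f"
    and "irrational_pseudo_rotation f"
  shows "topologically_transitive f"
proof -
  obtain g where g: "homeomorphism UNIV UNIV f g" using assms(1) by blast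
  have bij: "bij f"
    by (rule o_bij[of g]) (use g in \<open>auto simp: homeomorphism_def fun_eq_iff\<close>)
  obtain \<rho> F where F: "totally_irrational \<rho>" "is_lift F f"
    "\<And>z. (\<lambda>n. ((F ^^ n) z - z) /\<^sub>R real n) \<longlonglongrightarrow> \<rho>"
    using assms(4) unfolding irrational_pseudo_rotation_def by blast
  interpret pseudo_rotation_lift f F \<rho>
    by unfold_locales (use F bij assms(3) in \<open>auto simp: is_lift_def\<close>)
  \<comment> \<open>The saturation under the whole orbit relation is written with images and
    preimages of forward iterates, avoiding an inverse of \<open>F\<close>. Images are open by
    invariance of domain.\<close>
  define sat where "sat = (\<lambda>U. \<Union>m k. (F ^^ k) -` ((F ^^ m) ` (proj_torus -` U)))"
  have sat: "z \<in> sat U \<longleftrightarrow> (\<exists>m k y. proj_torus y \<in> U \<and> (F ^^ m) y = (F ^^ k) z)" for z U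
  proof
    assume "z \<in> sat U"
    then obtain m k where "(F ^^ k) z \<in> (F ^^ m) ` (proj_torus -` U)" unfolding sat_def by blast
    then obtain y where "proj_torus y \<in> U" "(F ^^ m) y = (F ^^ k) z" by auto
    then show "\<exists>m k y. proj_torus y \<in> U \<and> (F ^^ m) y = (F ^^ k) z" by blast
  next
    assume "\<exists>m k y. proj_torus y \<in> U \<and> (F ^^ m) y = (F ^^ k) z"
    then obtain m k y where y: "proj_torus y \<in> U" "(F ^^ m) y = (F ^^ k) z" by blast
    have "(F ^^ k) z \<in> (F ^^ m) ` (proj_torus -` U)"
      by (rule image_eqI[of _ _ y]) (use y in auto)
    then show "z \<in> sat U" unfolding sat_def by blast
  qed
  have inv: "invariant_open (sat U)" "sat U \<noteq> {}" if "open U" "U \<noteq> {}" for U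
  proof -
    show "invariant_open (sat U)" unfolding invariant_open_def
    proof (intro conjI ballI)
      show "open (sat U)" unfolding sat_def
        by (intro open_UN ballI open_vimage_funpow_lift open_image_funpow_lift open_vimage_proj_torus \<open>open U\<close>)
    next
      fix z assume "z \<in> sat U"
      then obtain m k y where y: "proj_torus y \<in> U" "(F ^^ m) y = (F ^^ k) z" unfolding sat by blast
      have "(F ^^ Suc m) y = (F ^^ k) (F z)"
        using y(2) by (simp add: funpow_swap1)
      then show "F z \<in> sat U" unfolding sat using y(1) by blast
    next
      fix z u :: "real^2" assume "z \<in> sat U" and u: "u \<in> int_lattice"
      then obtain m k y where y: "proj_torus y \<in> U" "(F ^^ m) y = (F ^^ k) z" unfolding sat by blast
      have "proj_torus (y + u) = proj_torus y" using u by (simp add: proj_torus_eq_iff)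
      then have "proj_torus (y + u) \<in> U" "(F ^^ m) (y + u) = (F ^^ k) (z + u)"
        using y u by (simp_all add: funpow_lift_add)
      then show "z + u \<in> sat U" unfolding sat by blast
    qed
    obtain t where "t \<in> U" using \<open>U \<noteq> {}\<close> by blast
    then obtain y where "proj_torus y \<in> U" using proj_torus_surj[of t] by auto
    then have "y \<in> sat U" unfolding sat by blast
    then show "sat U \<noteq> {}" by blast
  qed
  show ?thesis unfolding topologically_transitive_def
  proof (intro allI impI)
    fix U V :: "torus set" assume UV: "open U \<and> U \<noteq> {} \<and> open V \<and> V \<noteq> {}"
    then obtain z where "z \<in> sat U" "z \<in> sat V"
      using invariant_open_sets_meet[of "sat U" "sat V"] inv by blast
    then obtain m k y m' k' y' where y: "proj_torus y \<in> U" "(F ^^ m) y = (F ^^ k) z"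
      and y': "proj_torus y' \<in> V" "(F ^^ m') y' = (F ^^ k') z" unfolding sat by blast
    \<comment> \<open>Further iteration brings both orbits to the common point F^(k + k') z.\<close>
    have "(F ^^ (k' + m)) y = (F ^^ (k' + k)) z" by (simp add: funpow_add y)
    also have "\<dots> = (F ^^ (k + m')) y'" by (simp add: add.commute[of k'] funpow_add y')
    finally have "(f ^^ (k' + m)) (proj_torus y) = (f ^^ (k + m')) (proj_torus y')"
      by (simp only: funpow_lift[symmetric])
    from int_iterate_eqI[OF bij this]
    have "proj_torus y' \<in> int_iterate f (int (k' + m) - int (k + m')) ` U"
      using y(1) by (intro image_eqI[of _ _ "proj_torus y"]) auto
    then have "int_iterate f (int (k' + m) - int (k + m')) ` U \<inter> V \<noteq> {}" using y'(1) by auto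
    then show "\<exists>n::int. int_iterate f n ` U \<inter> V \<noteq> {}" by (rule exI)
  qed
qed

end
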